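(* Let $n$ be an integer with $n\ge 6$. Then the maximum number of Hamilton paths in a nonhamiltonian graph of order $n$ is $(n-2)!$, and, up to isomorphism, this maximum number is attained uniquely by the graph $K_{n-1}\cdot K_2$.
   Context: All graphs are finite and simple. The order of a graph is its number of vertices. A graph is nonhamiltonian if it contains no Hamilton cycle (a cycle through all vertices). A Hamilton path of a graph is a path subgraph containing all its vertices; paths are counted as subgraphs, so a path and its reversal are the same path. $K_n$ denotes the complete graph of order $n$. $K_{n-1}\cdot K_2$ denotes the graph of order $n$ obtained by identifying a vertex of $K_{n-1}$ with a vertex of $K_2$ (i.e. $K_{n-1}$ with one pendant edge attached at a vertex). *)

theory Defs
  imports Graph_Theory.Graph_Theory
begin

text \<open>
  A finite simple graph is a symmetric loop-free finite digraph without parallel arcs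
  (locale \<open>pair_graph\<close>): each undirected edge is a pair of opposite arcs. A graph of this
  type is determined by its vertex set and its arc set, so counting path subgraphs as records
  counts a path and its reversal once.
\<close>

definition path_graph :: "'a pair_pre_digraph \<Rightarrow> bool" where
  "path_graph P \<longleftrightarrow> (\<exists>xs. xs \<noteq> [] \<and> distinct xs \<and> pverts P = set xs \<and>
     parcs P = set (vwalk_arcs xs) \<union> (set (vwalk_arcs xs))\<inverse>)"

text \<open>The closed walk \<open>xs @ [hd xs]\<close> returns to its start; \<open>length xs \<ge> 3\<close> excludes
  traversing a single edge back and forth.\<close>

definition cycle_graph :: "'a pair_pre_digraph \<Rightarrow> bool" where
  "cycle_graph C \<longleftrightarrow> (\<exists>xs. length xs \<ge> 3 \<and> distinct xs \<and> pverts C = set xs \<and>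
     parcs C = set (vwalk_arcs (xs @ [hd xs])) \<union> (set (vwalk_arcs (xs @ [hd xs])))\<inverse>)"

definition hamilton_paths :: "'a pair_pre_digraph \<Rightarrow> 'a pair_pre_digraph set" where
  "hamilton_paths G = {P. path_graph P \<and> spanning (with_proj P) (with_proj G)}"

definition hamiltonian :: "'a pair_pre_digraph \<Rightarrow> bool" where
  "hamiltonian G \<longleftrightarrow> (\<exists>C. cycle_graph C \<and> spanning (with_proj C) (with_proj G))"

definition nonhamiltonian_graphs :: "nat \<Rightarrow> 'a pair_pre_digraph set" where
  "nonhamiltonian_graphs n = {G. pair_graph G \<and> card (pverts G) = n \<and> \<not> hamiltonian G}"

definition complete_graph_on :: "'a set \<Rightarrow> 'a pair_pre_digraph" where
  "complete_graph_on A = \<lparr> pverts = A, parcs = {(u, v). u \<in> A \<and> v \<in> A \<and> u \<noteq> v} \<rparr>"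

text \<open>The graph \<open>K\<^bsub>n-1\<^esub> \<cdot> K\<^bsub>2\<^esub>\<close> on \<open>{0..<n}\<close>, for \<open>n \<ge> 2\<close>: the complete graphs on
  \<open>{0..<n-1}\<close> and on \<open>{0, n-1}\<close> glued at their only common vertex \<open>0\<close>.\<close>

definition K_dot_K2 :: "nat \<Rightarrow> nat pair_pre_digraph" where
  "K_dot_K2 n = \<lparr>
     pverts = pverts (complete_graph_on {0..<n-1}) \<union> pverts (complete_graph_on {0, n-1}),
     parcs = parcs (complete_graph_on {0..<n-1}) \<union> parcs (complete_graph_on {0, n-1}) \<rparr>"

lemma complete_graph_on_complete:
  "finite A \<Longrightarrow> K\<^bsub>card A\<^esub> (with_proj (complete_graph_on A))"
  by (auto simp: complete_digraph_pair_def complete_graph_on_def)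

lemma K_dot_K2_common_vertex:
  fixes n :: nat
  assumes "n \<ge> 2"
  shows "pverts (complete_graph_on {0..<n-1}) \<inter> pverts (complete_graph_on {0, n-1}) = {0}"
  using assms by (auto simp: complete_graph_on_def)

lemma finite_hamilton_paths:
  assumes "pair_graph G"
  shows "finite (hamilton_paths G)"
proof -
  interpret pair_graph G by fact
  have "hamilton_paths G \<subseteq>
      (\<lambda>(V, E). \<lparr> pverts = V, parcs = E \<rparr>) ` (Pow (pverts G) \<times> Pow (parcs G))"
  proof
    fix P assume "P \<in> hamilton_paths G"
    then have "pverts P \<subseteq> pverts G" "parcs P \<subseteq> parcs G"
      by (auto simp: hamilton_paths_def spanning_def subgraph_def)
    then show "P \<in> (\<lambda>(V, E). \<lparr> pverts = V, parcs = E \<rparr>) ` (Pow (pverts G) \<times> Pow (parcs G))"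
      by (intro image_eqI[of _ _ "(pverts P, parcs P)"]) auto
  qed
  moreover have "finite (Pow (pverts G) \<times> Pow (parcs G))"
    using pair_finite_verts pair_finite_arcs by simp
  ultimately show ?thesis by (meson finite_imageI finite_subset)
qed

end

theory Submission
  imports Defs "HOL-Combinatorics.Multiset_Permutations"
begin

text \<open>
  Closing up a Hamilton path of a nonhamiltonian graph gives a cyclic arrangement of the vertices with
  exactly one non-edge, so it suffices to bound the arrangements with at most one non-edge. If some
  vertex has degree at most one, it is an end of every Hamilton path, and the bound with its equality
  case is immediate. Otherwise Posa's theorem gives \<open>k \<ge> 2\<close> with \<open>2k < n\<close> and at least \<open>k\<close> vertices
  of degree at most \<open>k\<close>. Let \<open>X\<close> count the non-edges at these vertices (exactly \<open>n - 1 - k\<close> chosen at each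
  of them) in a random cyclic arrangement. The first two moments of \<open>X\<close> depend only on the degree sequence
  of the graph of chosen non-edges, and a second moment estimate yields \<open>P(X \<le> 1) < 2/(n - 1)\<close>, which means
  strictly fewer than \<open>(n - 2)!\<close> Hamilton paths. Three small configurations escape the generic estimate; there
  an integer-valued quadratic polynomial replaces the square.
\<close>

section \<open>Moments of the number of marked edges in a cyclic arrangement\<close>

text \<open>In a nonhamiltonian graph each Hamilton path comes from two vertex lists, and each list
  has \<open>n\<close> rotations, all different and all with at most one marked pair. So fewer than
  \<open>(n-2)!\<close> paths follow once fewer than \<open>2 n (n-2)!\<close> of the
  \<open>n!\<close> arrangements have \<open>X \<le> 1\<close>, a proportion of
  \<open>2/(n-1)\<close>. With \<open>Y = X - 1\<close>, optimising \<open>E (1 - t Y)^2\<close>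
  over \<open>t \<ge> 0\<close> gives the one-sided Chebyshev bound
  \<open>1 - (E Y)^2 / E Y^2\<close>. Degree one has to be split off because the target is tight
  there: one vertex with \<open>n - 2\<close> marks gives \<open>X \<le> 1\<close> with probability
  exactly \<open>2/(n-1)\<close>. All non-edges together would have an uncontrolled degree sequence;
  marking the same number \<open>r\<close> at each of \<open>w\<close> vertices fixes the mean up to
  the marks inside that set, and Cauchy-Schwarz outside it bounds the only other parameter, the sum
  of squared degrees. The quadratics for the small cases have two consecutive integers as roots, so
  they are negative only where \<open>X\<close> takes no value.\<close>

lemma sum_permutations_of_set_Cons:
  assumes "finite V" "V \<noteq> {}"
  shows "sum f (permutations_of_set V) = (\<Sum>a\<in>V. \<Sum>ys\<in>permutations_of_set (V - {a}). f (a # ys))"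
proof -
  have "sum f (permutations_of_set V) = (\<Sum>a\<in>V. sum f ((#) a ` permutations_of_set (V - {a})))"
    unfolding permutations_of_set_nonempty[OF assms(2)]
    by (rule sum.UNION_disjoint) (use assms in auto)
  also have "\<dots> = (\<Sum>a\<in>V. \<Sum>ys\<in>permutations_of_set (V - {a}). f (a # ys))"
    by (rule sum.cong[OF refl], subst sum.reindex) auto
  finally show ?thesis .
qed

text \<open>All positions are alike in a uniform ordering: completing \<open>is\<close> to a
  permutation \<open>js\<close> of the positions gives a bijection of the orderings that moves the
  chosen positions to the front.\<close>

lemma sum_permutations_of_set_nth:
  assumes "finite V" "distinct is" "set is \<subseteq> {..<card V}"
  shows "(\<Sum>xs\<in>permutations_of_set V. f (map ((!) xs) is)) =
         (\<Sum>xs\<in>permutations_of_set V. f (take (length is) xs))"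
proof -
  define js where "js = is @ filter (\<lambda>i. i \<notin> set is) [0..<card V]"
  have js: "distinct js" "set js = {..<card V}"
    using assms(2,3) by (auto simp: js_def)
  let ?P = "permutations_of_set V"
  let ?g = "\<lambda>xs :: 'a list. map ((!) xs) js"
  have len: "length xs = card V" if "xs \<in> ?P" for xs
    using that by (auto simp: permutations_of_set_def distinct_card)
  have inj: "inj_on ?g ?P"
  proof (rule inj_onI)
    fix xs ys assume *: "xs \<in> ?P" "ys \<in> ?P" "?g xs = ?g ys"
    show "xs = ys"
    proof (rule nth_equalityI)
      show "length xs = length ys" using * len by simp
      fix i assume "i < length xs"
      then have "i \<in> set js" using len * js by auto
      then show "xs ! i = ys ! i" using *(3) by auto
    qed
  qed
  have "?g ` ?P \<subseteq> ?P"
  proof safe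
    fix xs assume xs: "xs \<in> ?P"
    then have "distinct xs" "set xs = V" by (auto simp: permutations_of_set_def)
    moreover have "distinct (?g xs)"
      unfolding distinct_map using js \<open>distinct xs\<close> len[OF xs] by (simp add: inj_on_nth)
    moreover have "set (?g xs) = set xs"
      unfolding set_map js(2) set_conv_nth[of xs] len[OF xs] by auto
    ultimately show "?g xs \<in> ?P"
      by (simp add: permutations_of_set_def)
  qed
  then have "bij_betw ?g ?P ?P"
    using inj assms(1) by (simp add: bij_betw_def endo_inj_surj)
  then have "(\<Sum>xs\<in>?P. f (take (length is) xs)) = (\<Sum>xs\<in>?P. f (take (length is) (?g xs)))"
    by (rule sum.reindex_bij_betw[symmetric])
  also have "\<dots> = (\<Sum>xs\<in>?P. f (map ((!) xs) is))"
    by (simp add: js_def)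
  finally show ?thesis by simp
qed

text \<open>Removing one element per level yields nested sums over
  \<open>V - {a} - {b} - ...\<close>, the shape that \<open>sum_diff1'\<close> evaluates.\<close>

primrec distinct_sum :: "nat \<Rightarrow> 'a set \<Rightarrow> ('a list \<Rightarrow> real) \<Rightarrow> real" where
  "distinct_sum 0 V f = f []"
| "distinct_sum (Suc k) V f = (\<Sum>a\<in>V. distinct_sum k (V - {a}) (\<lambda>l. f (a # l)))"

lemma sum_permutations_of_set_take:
  assumes "finite V" "k \<le> card V"
  shows "(\<Sum>xs\<in>permutations_of_set V. f (take k xs)) = fact (card V - k) * distinct_sum k V f"
  using assms
proof (induction k arbitrary: V f)
  case (Suc k)
  then have "V \<noteq> {}" by auto
  then have "(\<Sum>xs\<in>permutations_of_set V. f (take (Suc k) xs)) =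
      (\<Sum>a\<in>V. \<Sum>ys\<in>permutations_of_set (V - {a}). f (a # take k ys))"
    using Suc.prems by (simp add: sum_permutations_of_set_Cons)
  also have "\<dots> = (\<Sum>a\<in>V. fact (card V - Suc k) * distinct_sum k (V - {a}) (\<lambda>l. f (a # l)))"
    using Suc.prems
    by (intro sum.cong refl, subst Suc.IH[where f = "\<lambda>l. f (_ # l)"]) auto
  finally show ?case by (simp add: sum_distrib_left)
qed simp

lemma sum_permutations_of_set_distinct_sum:
  assumes "finite V" "distinct is" "set is \<subseteq> {..<card V}"
  shows "(\<Sum>xs\<in>permutations_of_set V. f (map ((!) xs) is)) =
         fact (card V - length is) * distinct_sum (length is) V f"
proof -
  have "length is \<le> card V"
    using card_mono[of "{..<card V}" "set is"] assms by (simp add: distinct_card)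
  then show ?thesis
    using assms by (simp add: sum_permutations_of_set_nth sum_permutations_of_set_take)
qed

section \<open>First and second moments of the number of marked pairs\<close>

locale edge_count =
  fixes V :: "'a set" and H :: "'a \<Rightarrow> 'a \<Rightarrow> bool"
  assumes finV: "finite V"
    and Hsym: "H x y \<Longrightarrow> H y x"
    and Hirr: "\<not> H x x"
begin

abbreviation "n \<equiv> card V"

definition h :: "'a \<Rightarrow> 'a \<Rightarrow> real" where "h x y = of_bool (H x y)"

definition D :: "'a \<Rightarrow> real" where "D x = (\<Sum>y\<in>V. h x y)"

definition S :: real where "S = (\<Sum>x\<in>V. D x)"

definition Q :: real where "Q = (\<Sum>x\<in>V. (D x)\<^sup>2)"

definition sc :: "nat \<Rightarrow> nat" where "sc i = Suc i mod n"

definition X :: "'a list \<Rightarrow> nat" where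
  "X xs = card {i\<in>{..<n}. H (xs ! i) (xs ! sc i)}"

lemma h_sym: "h x y = h y x"
  using Hsym by (auto simp: h_def)

lemma h_irr [simp]: "h x x = 0"
  using Hirr by (auto simp: h_def)

lemma D_alt: "(\<Sum>x\<in>V. h x y) = D y"
  by (simp add: D_def h_sym[of _ y])

lemma h_idem [simp]: "h x y * h x y = h x y" "h x y * (h x y * z) = h x y * z"
  by (auto simp: h_def)

lemma sum_diff1': "a \<in> A \<Longrightarrow> finite A \<Longrightarrow> (\<Sum>x\<in>A - {a}. f x) = (\<Sum>x\<in>A. f x) - (f a :: real)"
  by (simp add: sum_diff1)

lemma distinct_sum2: "distinct_sum 2 V (\<lambda>l. h (l!0) (l!1)) = S"
  using finV by (simp add: numeral_eq_Suc sum_diff1' S_def D_def)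

text \<open>A middle vertex \<open>b\<close> lies on \<open>D b * (D b - 1)\<close> ordered marked
  paths of length two.\<close>

lemma distinct_sum3: "distinct_sum 3 V (\<lambda>l. h (l!0) (l!1) * h (l!1) (l!2)) = Q - S"
proof -
  have "distinct_sum 3 V (\<lambda>l. h (l!0) (l!1) * h (l!1) (l!2)) =
      (\<Sum>a\<in>V. \<Sum>b\<in>V - {a}. \<Sum>c\<in>V - {a} - {b}. h a b * h b c)"
    by (simp add: numeral_eq_Suc)
  also have "\<dots> = (\<Sum>a\<in>V. \<Sum>b\<in>V - {a}. h a b * D b - h a b)"
  proof (intro sum.cong refl)
    fix a b assume ab: "a \<in> V" "b \<in> V - {a}"
    have "(\<Sum>c\<in>V - {a} - {b}. h a b * h b c) = h a b * (D b - h b a - h b b)"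
      unfolding sum_distrib_left[symmetric] using ab finV by (simp add: sum_diff1' D_def)
    then show "(\<Sum>c\<in>V - {a} - {b}. h a b * h b c) = h a b * D b - h a b"
      by (simp add: algebra_simps h_sym[of b a])
  qed
  also have "\<dots> = (\<Sum>a\<in>V. \<Sum>b\<in>V. h a b * D b - h a b)"
    using finV by (intro sum.cong[OF refl]) (simp add: sum_diff1')
  also have "\<dots> = (\<Sum>a\<in>V. \<Sum>b\<in>V. h a b * D b) - S"
    by (simp add: sum_subtractf S_def D_def)
  also have "(\<Sum>a\<in>V. \<Sum>b\<in>V. h a b * D b) = Q"
    by (subst sum.swap) (simp add: Q_def D_alt power2_eq_square flip: sum_distrib_right)
  finally show ?thesis .
qed

text \<open>Inclusion-exclusion over pairs of oriented marked edges: each of the four ways to share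
  an end removes \<open>Q\<close>, and each of the two ways to share both ends was removed twice, so
  \<open>S\<close> is restored for it.\<close>

lemma distinct_sum4: "distinct_sum 4 V (\<lambda>l. h (l!0) (l!1) * h (l!2) (l!3)) = S\<^sup>2 - 4 * Q + 2 * S"
proof -
  have "distinct_sum 4 V (\<lambda>l. h (l!0) (l!1) * h (l!2) (l!3)) =
      (\<Sum>a\<in>V. \<Sum>b\<in>V - {a}. \<Sum>c\<in>V - {a} - {b}. \<Sum>d\<in>V - {a} - {b} - {c}. h a b * h c d)"
    by (simp add: numeral_eq_Suc)
  also have "\<dots> = (\<Sum>a\<in>V. \<Sum>b\<in>V - {a}. h a b * (S - 2 * D a - 2 * D b + 2 * h a b))"
  proof (intro sum.cong refl)
    fix a b assume ab: "a \<in> V" "b \<in> V - {a}"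
    have "(\<Sum>c\<in>V - {a} - {b}. \<Sum>d\<in>V - {a} - {b} - {c}. h a b * h c d) =
        (\<Sum>c\<in>V - {a} - {b}. h a b * (D c - h c a - h c b))"
      unfolding sum_distrib_left[symmetric] 
      using ab finV by (intro arg_cong[where f = "(*) _"] sum.cong refl) (simp add: sum_diff1' D_def)
    also have "\<dots> = h a b * ((\<Sum>c\<in>V. D c - h c a - h c b) - (D a - h a a - h a b) - (D b - h b a - h b b))"
      unfolding sum_distrib_left[symmetric] using ab finV by (simp add: sum_diff1')
    also have "(\<Sum>c\<in>V. D c - h c a - h c b) = S - D a - D b"
      by (simp add: sum_subtractf S_def D_def h_sym[of _ a] h_sym[of _ b])
    finally show "(\<Sum>c\<in>V - {a} - {b}. \<Sum>d\<in>V - {a} - {b} - {c}. h a b * h c d) =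
        h a b * (S - 2 * D a - 2 * D b + 2 * h a b)"
      by (simp add: h_sym[of b a] algebra_simps)
  qed
  also have "\<dots> = (\<Sum>a\<in>V. \<Sum>b\<in>V. h a b * (S - 2 * D a - 2 * D b + 2 * h a b))"
    using finV by (intro sum.cong[OF refl]) (simp add: sum_diff1')
  also have "\<dots> = (\<Sum>a\<in>V. \<Sum>b\<in>V. h a b) * S - 2 * (\<Sum>a\<in>V. \<Sum>b\<in>V. h a b * D a)
       - 2 * (\<Sum>a\<in>V. \<Sum>b\<in>V. h a b * D b) + 2 * (\<Sum>a\<in>V. \<Sum>b\<in>V. h a b)"
    by (simp add: algebra_simps sum_subtractf sum.distrib sum_distrib_left sum_distrib_right)
  also have "(\<Sum>a\<in>V. \<Sum>b\<in>V. h a b * D b) = Q"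
    by (subst sum.swap) (simp add: Q_def D_alt power2_eq_square flip: sum_distrib_right)
  also have "(\<Sum>a\<in>V. \<Sum>b\<in>V. h a b * D a) = Q"
    by (simp add: Q_def D_def power2_eq_square flip: sum_distrib_right)
  also have "(\<Sum>a\<in>V. \<Sum>b\<in>V. h a b) = S"
    by (simp add: S_def D_def)
  finally show ?thesis by (simp add: power2_eq_square algebra_simps)
qed

definition e :: "'a list \<Rightarrow> nat \<Rightarrow> real" where
  "e xs i = h (xs ! i) (xs ! sc i)"

lemma X_sum: "real (X xs) = (\<Sum>i<n. e xs i)"
  by (simp add: X_def e_def h_def of_bool_def flip: sum.inter_filter)

lemma sc_less: "0 < n \<Longrightarrow> sc i < n"
  by (simp add: sc_def)

lemma sc_neq: "2 \<le> n \<Longrightarrow> i < n \<Longrightarrow> sc i \<noteq> i"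
  by (cases "Suc i = n") (auto simp: sc_def)

lemma sc_sc_neq: "3 \<le> n \<Longrightarrow> i < n \<Longrightarrow> sc (sc i) \<noteq> i"
  by (cases "Suc i = n"; cases "Suc (Suc i) = n") (auto simp: sc_def)

lemma sc_inj: "i < n \<Longrightarrow> j < n \<Longrightarrow> sc i = sc j \<longleftrightarrow> i = j"
  by (cases "Suc i = n"; cases "Suc j = n") (auto simp: sc_def)

lemma ex_pred: assumes "i < n" shows "\<exists>j<n. sc j = i"
proof (cases i)
  case 0
  then show ?thesis using assms by (intro exI[of _ "n - 1"]) (auto simp: sc_def)
next
  case (Suc j)
  then show ?thesis using assms by (intro exI[of _ j]) (auto simp: sc_def)
qed

lemma sum_e:
  assumes "2 \<le> n" "i < n"
  shows "(\<Sum>xs\<in>permutations_of_set V. e xs i) = fact (n - 2) * S"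
proof -
  have "(\<Sum>xs\<in>permutations_of_set V. e xs i) =
      (\<Sum>xs\<in>permutations_of_set V. (\<lambda>l. h (l!0) (l!1)) (map ((!) xs) [i, sc i]))"
    by (simp add: e_def)
  also have "\<dots> = fact (n - length [i, sc i]) * distinct_sum (length [i, sc i]) V (\<lambda>l. h (l!0) (l!1))"
    using sc_neq[of i] sc_less[of i] assms finV
    by (intro sum_permutations_of_set_distinct_sum) (auto simp: eq_commute)
  finally show ?thesis using distinct_sum2 by (simp add: numeral_2_eq_2)
qed

lemma sum_e_e_sc:
  assumes "3 \<le> n" "i < n"
  shows "(\<Sum>xs\<in>permutations_of_set V. e xs i * e xs (sc i)) = fact (n - 3) * (Q - S)"
proof -
  let ?f = "\<lambda>l. h (l!0) (l!1) * h (l!1) (l!2)"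
  have "(\<Sum>xs\<in>permutations_of_set V. e xs i * e xs (sc i)) =
      (\<Sum>xs\<in>permutations_of_set V. ?f (map ((!) xs) [i, sc i, sc (sc i)]))"
    by (simp add: e_def)
  also have "\<dots> = fact (n - length [i, sc i, sc (sc i)]) * distinct_sum (length [i, sc i, sc (sc i)]) V ?f"
    using sc_neq[of i] sc_less[of i] sc_neq[of "sc i"] sc_less[of "sc i"] sc_sc_neq[of i] assms finV
    by (intro sum_permutations_of_set_distinct_sum) (auto simp: eq_commute)
  finally show ?thesis using distinct_sum3 by (simp add: numeral_3_eq_3 numeral_2_eq_2)
qed

lemma sum_e_e_far:
  assumes "4 \<le> n" "i < n" "j < n" "j \<noteq> i" "j \<noteq> sc i" "sc j \<noteq> i"
  shows "(\<Sum>xs\<in>permutations_of_set V. e xs i * e xs j) = fact (n - 4) * (S\<^sup>2 - 4 * Q + 2 * S)"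
proof -
  let ?f = "\<lambda>l. h (l!0) (l!1) * h (l!2) (l!3)"
  have "(\<Sum>xs\<in>permutations_of_set V. e xs i * e xs j) =
      (\<Sum>xs\<in>permutations_of_set V. ?f (map ((!) xs) [i, sc i, j, sc j]))"
    by (simp add: e_def)
  also have "\<dots> = fact (n - length [i, sc i, j, sc j]) * distinct_sum (length [i, sc i, j, sc j]) V ?f"
    using sc_neq[of i] sc_less[of i] sc_neq[of j] sc_less[of j] sc_inj[of i j] assms finV
    by (intro sum_permutations_of_set_distinct_sum) (auto simp: eq_commute)
  also have "length [i, sc i, j, sc j] = 4" by simp
  finally show ?thesis using distinct_sum4 by simp
qed

text \<open>Position \<open>i\<close> meets itself, its two cyclic neighbours, and
  \<open>n - 3\<close> positions disjoint from it. Between the last two kinds the terms linear in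
  \<open>S\<close> cancel.\<close>

lemma sum_e_X:
  assumes "4 \<le> n" "i < n"
  shows "(\<Sum>xs\<in>permutations_of_set V. e xs i * real (X xs)) =
    fact (n - 2) * S + fact (n - 3) * (S\<^sup>2 - 2 * Q)"
proof -
  obtain p where p: "p < n" "sc p = i" using ex_pred[OF assms(2)] by blast
  let ?A = "{i, sc i, p}"
  let ?f = "\<lambda>j. \<Sum>xs\<in>permutations_of_set V. e xs i * e xs j"
  have d: "i \<noteq> sc i" "i \<noteq> p" "sc i \<noteq> p"
    using sc_neq[of i] sc_neq[of p] sc_sc_neq[of p] assms p by auto
  have A: "?A \<subseteq> {..<n}" using sc_less[of i] assms p by auto
  have "(\<Sum>xs\<in>permutations_of_set V. e xs i * real (X xs)) = (\<Sum>j<n. ?f j)"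
    by (subst sum.swap) (simp add: X_sum sum_distrib_left)
  also have "\<dots> = (\<Sum>j\<in>?A. ?f j) + (\<Sum>j\<in>{..<n} - ?A. ?f j)"
    using A by (subst sum.subset_diff[of ?A]) auto
  also have "(\<Sum>j\<in>?A. ?f j) = ?f i + ?f (sc i) + ?f p"
    using d by simp
  also have "?f i = fact (n - 2) * S"
    using sum_e[of i] assms by (simp add: e_def)
  also have "?f (sc i) = fact (n - 3) * (Q - S)"
    using sum_e_e_sc[of i] assms by simp
  also have "?f p = fact (n - 3) * (Q - S)"
    using sum_e_e_sc[of p] assms p by (simp add: mult.commute)
  also have "(\<Sum>j\<in>{..<n} - ?A. ?f j) = (\<Sum>j\<in>{..<n} - ?A. fact (n - 4) * (S\<^sup>2 - 4 * Q + 2 * S))"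
    using assms p sc_inj[of _ p] by (intro sum.cong[OF refl] sum_e_e_far) auto
  also have "\<dots> = real (n - 3) * fact (n - 4) * (S\<^sup>2 - 4 * Q + 2 * S)"
    using A d by (simp add: card_Diff_subset)
  also have "real (n - 3) * fact (n - 4) = fact (n - 3)"
    using assms fact_reduce[of "n - 3", where 'a = real] by simp
  finally show ?thesis by (simp add: algebra_simps)
qed

lemma sum_X:
  assumes "4 \<le> n"
  shows "(\<Sum>xs\<in>permutations_of_set V. real (X xs)) = real n * fact (n - 2) * S"
  using assms unfolding X_sum by (subst sum.swap) (simp add: sum_e)

lemma sum_X_sq:
  assumes "4 \<le> n"
  shows "(\<Sum>xs\<in>permutations_of_set V. (real (X xs))\<^sup>2) =
    real n * (fact (n - 2) * S + fact (n - 3) * (S\<^sup>2 - 2 * Q))"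
proof -
  have "(\<Sum>xs\<in>permutations_of_set V. (real (X xs))\<^sup>2) =
      (\<Sum>i<n. \<Sum>xs\<in>permutations_of_set V. e xs i * real (X xs))"
    by (subst sum.swap) (simp add: power2_eq_square X_sum sum_distrib_right)
  then show ?thesis using assms by (simp add: sum_e_X)
qed

section \<open>From two moments to a tail bound\<close>

definition low :: "'a list set" where
  "low = {xs \<in> permutations_of_set V. X xs \<le> 1}"

lemma fact_n:
  assumes "4 \<le> n"
  shows "fact n = real n * (real n - 1) * (real n - 2) * fact (n - 3)"
    and "fact (n - 2) = (real n - 2) * fact (n - 3)"
proof -
  obtain k where "n = 3 + k" using assms le_Suc_ex[of 3 n] by auto
  then show "fact n = real n * (real n - 1) * (real n - 2) * fact (n - 3)"
    and "fact (n - 2) = (real n - 2) * fact (n - 3)"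
    by (simp_all add: numeral_3_eq_3 algebra_simps)
qed

text \<open>Markov's inequality; \<open>z\<close> records where the polynomial exceeds the indicator function.\<close>

lemma card_low_le:
  assumes n: "4 \<le> n"
    and g: "\<And>xs. xs \<in> permutations_of_set V \<Longrightarrow>
        of_bool (X xs \<le> 1) + z xs \<le> a + b * real (X xs) + c * (real (X xs))\<^sup>2"
  shows "real (card low) + (\<Sum>xs\<in>permutations_of_set V. z xs) \<le>
    real n * fact (n - 3) * (a * (real n - 1) * (real n - 2) + (b + c) * (real n - 2) * S + c * (S\<^sup>2 - 2 * Q))"
proof -
  have "real (card low) + (\<Sum>xs\<in>permutations_of_set V. z xs) =
      (\<Sum>xs\<in>permutations_of_set V. of_bool (X xs \<le> 1) + z xs)"
    using finV by (simp add: low_def sum.distrib of_bool_def flip: sum.inter_filter)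
  also have "\<dots> \<le> (\<Sum>xs\<in>permutations_of_set V. a + b * real (X xs) + c * (real (X xs))\<^sup>2)"
    using g by (rule sum_mono)
  also have "\<dots> = fact n * a + b * (real n * fact (n - 2) * S) +
      c * (real n * (fact (n - 2) * S + fact (n - 3) * (S\<^sup>2 - 2 * Q)))"
    using finV n by (simp add: sum.distrib sum_X sum_X_sq flip: sum_distrib_left)
  also have "\<dots> = real n * fact (n - 3) * (a * (real n - 1) * (real n - 2) + (b + c) * (real n - 2) * S + c * (S\<^sup>2 - 2 * Q))"
    unfolding fact_n[OF n] by (simp add: algebra_simps)
  finally show ?thesis .
qed

text \<open>The choice \<open>t = A / B\<close> minimises the bound \<open>K - 2tA + t\<^sup>2B\<close> obtained from \<open>(1 - t(X - 1))\<^sup>2\<close>.\<close>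

lemma card_low_less:
  assumes n: "4 \<le> n" and S: "real n - 1 \<le> S"
    and crit: "(real n - 2) * (real n + 1) * S < S\<^sup>2 + 2 * (real n - 3) * Q + 2 * (real n - 1) * (real n - 2)"
  shows "real (card low) < 2 * real n * fact (n - 2)"
proof -
  \<comment> \<open>\<open>A / K\<close> and \<open>B / K\<close> are the means of
    \<open>X - 1\<close> and of its square.\<close>
  define K where "K = (real n - 1) * (real n - 2)"
  define A where "A = (real n - 2) * (S - (real n - 1))"
  define B where "B = S\<^sup>2 - 2 * Q - (real n - 2) * S + K"
  have K: "K > 0" and A: "A \<ge> 0"
    using n S by (auto simp: K_def A_def)
  have *: "real (card low) \<le> real n * fact (n - 3) * (K - 2 * t * A + t\<^sup>2 * B)" if "t \<ge> 0" for t
  proof -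
    have "of_bool (X xs \<le> 1) \<le> (1 - t * (real (X xs) - 1))\<^sup>2" for xs
    proof (cases "X xs \<le> 1")
      case True
      then have "0 \<le> t * (1 - real (X xs))" using that by simp
      then have "1 \<le> 1 - t * (real (X xs) - 1)" by (simp add: algebra_simps)
      then show ?thesis using True by (simp add: one_le_power)
    qed simp
    moreover have "(1 - t * (real x - 1))\<^sup>2 = (1 + t)\<^sup>2 + (- 2 * t * (1 + t)) * real x + t\<^sup>2 * (real x)\<^sup>2" for x
      by (simp add: power2_eq_square algebra_simps)
    ultimately have "real (card low) + (\<Sum>xs\<in>permutations_of_set V. 0) \<le> real n * fact (n - 3) *
       ((1 + t)\<^sup>2 * (real n - 1) * (real n - 2) + (- 2 * t * (1 + t) + t\<^sup>2) * (real n - 2) * S + t\<^sup>2 * (S\<^sup>2 - 2 * Q))"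
      by (intro card_low_le n) auto
    also have "(1 + t)\<^sup>2 * (real n - 1) * (real n - 2) + (- 2 * t * (1 + t) + t\<^sup>2) * (real n - 2) * S + t\<^sup>2 * (S\<^sup>2 - 2 * Q)
       = K - 2 * t * A + t\<^sup>2 * B"
      by (simp add: K_def A_def B_def power2_eq_square algebra_simps)
    finally show ?thesis by simp
  qed
  \<comment> \<open>For \<open>B > 0\<close>, division by \<open>K * B\<close> turns this into
    \<open>(E Y)^2 / E Y^2 > (n - 3)/(n - 1)\<close> with \<open>Y = X - 1\<close>, the complement
    of the target \<open>2/(n - 1)\<close>.\<close>
  have AB: "(real n - 2) * (real n - 3) * B < A\<^sup>2"
  proof -
    have "(real n - 3) * B < (real n - 2) * (S - (real n - 1))\<^sup>2"
      using crit by (simp add: B_def K_def power2_eq_square algebra_simps)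
    then have "(real n - 2) * ((real n - 3) * B) < (real n - 2) * ((real n - 2) * (S - (real n - 1))\<^sup>2)"
      using n by (intro mult_strict_left_mono) auto
    then show ?thesis by (simp add: A_def power2_eq_square algebra_simps)
  qed
  have "\<exists>t\<ge>0. K - 2 * t * A + t\<^sup>2 * B < 2 * (real n - 2)"
  proof (cases "B > 0")
    case True
    have "K - 2 * (A / B) * A + (A / B)\<^sup>2 * B = K - A\<^sup>2 / B"
      using True by (simp add: power2_eq_square field_simps)
    also have "\<dots> < K - (real n - 2) * (real n - 3)"
      using AB True by (simp add: field_simps)
    also have "\<dots> = 2 * (real n - 2)" by (simp add: K_def algebra_simps)
    finally show ?thesis using True A by (intro exI[of _ "A / B"]) auto
  next
    \<comment> \<open>As a multiple of the mean of a square, \<open>B\<close> is never negative.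
      Instead of deriving this, a suitable \<open>t\<close> is exhibited:
      \<open>1 + K / (- B)\<close> lets the square term outweigh \<open>K\<close>, and
      \<open>K / A\<close> turns \<open>K - 2 * t * A\<close> into \<open>- K\<close>.\<close>
    case False
    show ?thesis
    proof (cases "A = 0")
      case True
      then have "B < 0" using AB n False by (cases "B = 0") auto
      define t where "t = 1 + K / (- B)"
      have "0 \<le> K / (- B)" using \<open>B < 0\<close> K by (intro divide_nonneg_pos) auto
      then have "t \<ge> 1" by (simp add: t_def)
      then have "t\<^sup>2 * (- B) \<ge> t * (- B)"
        using \<open>B < 0\<close> by (intro mult_right_mono) (auto simp: power2_eq_square)
      also have "t * (- B) = K - B" using \<open>B < 0\<close> by (simp add: t_def field_simps)
      finally have "K - 2 * t * A + t\<^sup>2 * B \<le> B" using True by simp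
      then show ?thesis using \<open>B < 0\<close> n \<open>t \<ge> 1\<close> by (intro exI[of _ t]) auto
    next
      case False
      then have "A > 0" using A by simp
      define Y where "Y = (K / A)\<^sup>2 * B"
      have "Y \<le> 0" using \<open>\<not> B > 0\<close> by (simp add: Y_def mult_nonneg_nonpos)
      moreover have "0 < 2 * (real n - 2)" using n by simp
      ultimately have "- K + Y < 2 * (real n - 2)" using K by linarith
      moreover have "K - 2 * (K / A) * A + (K / A)\<^sup>2 * B = - K + Y"
        using \<open>A > 0\<close> by (simp add: Y_def)
      ultimately have "K - 2 * (K / A) * A + (K / A)\<^sup>2 * B < 2 * (real n - 2)" by simp
      then show ?thesis using \<open>A > 0\<close> K by (intro exI[of _ "K / A"]) auto
    qed
  qed
  then obtain t where t: "t \<ge> 0" "K - 2 * t * A + t\<^sup>2 * B < 2 * (real n - 2)" by blast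
  have "real (card low) \<le> real n * fact (n - 3) * (K - 2 * t * A + t\<^sup>2 * B)"
    using * t by blast
  also have "\<dots> < real n * fact (n - 3) * (2 * (real n - 2))"
    using t n by (intro mult_strict_left_mono) auto
  also have "\<dots> = 2 * real n * fact (n - 2)"
    unfolding fact_n(2)[OF n] by simp
  finally show ?thesis .
qed

end

section \<open>Numerical inequalities\<close>

lemma quadratic_pos:
  fixes a b c s :: real
  assumes "a > 0" "4 * a * c - b\<^sup>2 > 0"
  shows "a * s\<^sup>2 + b * s + c > 0"
proof -
  have "4 * a * (a * s\<^sup>2 + b * s + c) = (2 * a * s + b)\<^sup>2 + (4 * a * c - b\<^sup>2)"
    by (simp add: power2_eq_square algebra_simps)
  also have "\<dots> > 0" using assms(2) by (simp add: add_nonneg_pos)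
  finally show ?thesis using assms(1) by (simp add: zero_less_mult_iff)
qed

text \<open>With denominators cleared, this says that the one-sided Chebyshev bound for
  \<open>X \<le> 1\<close> is below \<open>2/(n - 1)\<close>; it is the hypothesis
  \<open>crit\<close> of \<open>card_low_less\<close>.\<close>

definition criterion :: "real \<Rightarrow> real \<Rightarrow> real \<Rightarrow> bool" where
    "criterion n S Q \<longleftrightarrow> (n - 2) * (n + 1) * S < S\<^sup>2 + 2 * (n - 3) * Q + 2 * (n
      - 1) * (n - 2)"

text \<open>For \<open>n \<ge> 3\<close> the right side of the criterion does not decrease in
  \<open>Q\<close>, so \<open>Q\<close> may be replaced by its lower bound: \<open>w\<close> degrees
  equal to \<open>r\<close> and a total degree \<open>s\<close> spread evenly over the other
  \<open>n - w\<close> vertices. Multiplying by \<open>n - w\<close> removes the fraction.\<close>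

lemma criterionI:
  assumes "n > w" "n \<ge> 3" "Q \<ge> w * r\<^sup>2 + s\<^sup>2 / (n - w)"
    "0 < (n - w) * ((w * r + s)\<^sup>2 + 2 * (n - 3) * w * r\<^sup>2 + 2 * (n - 1) * (n - 2)
          - (n - 2) * (n + 1) * (w * r + s)) + 2 * (n - 3) * s\<^sup>2"
  shows "criterion n (w * r + s) Q"
proof -
  let ?Q = "w * r\<^sup>2 + s\<^sup>2 / (n - w)"
  let ?E = "(w * r + s)\<^sup>2 + 2 * (n - 3) * ?Q + 2 * (n - 1) * (n - 2) - (n - 2) * (n + 1) * (w * r + s)"
  have "(n - w) * (s\<^sup>2 / (n - w)) = s\<^sup>2" using assms(1) by simp
    then have "(n - w) * ?E = (n - w) * ((w * r + s)\<^sup>2 + 2 * (n - 3) * w * r\<^sup>2 + 2 * (n - 1)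
      * (n - 2)
          - (n - 2) * (n + 1) * (w * r + s)) + 2 * (n - 3) * s\<^sup>2"
    by algebra
  then have "0 < ?E" using assms(1,4) by (metis diff_gt_0_iff_gt zero_less_mult_pos)
  moreover have "2 * (n - 3) * ?Q \<le> 2 * (n - 3) * Q"
    using assms(2,3) by (intro mult_left_mono) auto
  ultimately show ?thesis unfolding criterion_def by linarith
qed

text \<open>
  Below, \<open>w\<close> is the number of vertices of small degree, each carrying \<open>r\<close> marked non-edges, and \<open>s\<close> is the
  number of marked non-edges leaving this set. Multiplied by \<open>n - w\<close>, the claim is the positivity of a
  quadratic polynomial in \<open>s\<close>, whose discriminant is negative for \<open>p \<le> 6w\<close>; for \<open>p \<ge> 6w\<close> the polynomial
  decreases up to the largest admissible value \<open>s = wr\<close>.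
\<close>

lemma criterion_even:
  fixes n w r s p Q :: real
  assumes w: "w \<ge> 4" and p: "p \<ge> 0" and n: "n = 2 * w + 2 + p" and r: "r = w + 1 + p"
    and s: "s \<le> w * r" and Q: "Q \<ge> w * r\<^sup>2 + s\<^sup>2 / (n - w)"
  shows "criterion n (w * r + s) Q"
proof (rule criterionI)
  \<comment> \<open>Shifting \<open>w\<close> by its least value makes the polynomials below have
    only nonnegative coefficients, so that positivity can be read off term by term.\<close>
  obtain q where q: "w = 4 + q" "q \<ge> 0" using w by (metis add.commute diff_add_cancel diff_ge_0_iff_ge)
  define a where "a = 3*p + 5*w"
  define b where "b = - 4*p*w^2 - 3*p^2*w - p^3 - 2*w^3 - 11*p*w - 5*p^2 - 8*w^2 - 6*p - 8*w"
    define c where "c = 5*p*w^4 + 8*p^2*w^3 + 5*p^3*w^2 + p^4*w + w^5 + 3*p*w^3 + 3*p^2*w^2 + p^2*w +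
      2*p^3 - w^3 + 10*p*w + 6*p^2 + 8*w^2 + 4*p + 4*w"
  have F: "(n - w) * ((w * r + s)\<^sup>2 + 2 * (n - 3) * w * r\<^sup>2 + 2 * (n - 1) * (n - 2)
          - (n - 2) * (n + 1) * (w * r + s)) + 2 * (n - 3) * s\<^sup>2 = a * s\<^sup>2 + b * s + c"
    unfolding a_def b_def c_def n r by algebra
  have a: "a > 0" using w p by (simp add: a_def)
  have "a * s\<^sup>2 + b * s + c > 0"
  proof (cases "p \<le> 6 * w")
    case True
        define d where "d = 80*p*w^4 + 112*p^2*w^3 + 56*p^3*w^2 + 7*p^4*w - p^5 + 16*w^5 - 144*p*w^3 -
        140*p^2*w^2 - 58*p^3*w - 8*p^4 - 64*w^4 + 3*p^2*w + 3*p^3 + 12*w^3 + 16*p*w + 6*p^2 + 8*w^2"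
        have "0 < 80*p*q^4 + 112*p^2*q^3 + 56*p^3*q^2 + p^4*q + 16*q^5 + 1136*p*q^3 + 1204*p^2*q^2 +
        366*p^3*q + 256*q^4 + 5952*p*q^2 + 4259*p^2*q + 571*p^3 + 1548*q^3 + 13584*p*q + 4946*p^2 +
        4248*q^2 + 11328*p + 4736*q + 896"
      using p q(2) by (intro add_nonneg_pos add_nonneg_nonneg mult_nonneg_nonneg zero_le_power) auto
    \<comment> \<open>Taking off these nonnegative multiples of \<open>6 * w - p\<close> removes the
      terms \<open>- p^5\<close> and \<open>- 8*p^4\<close> of \<open>d\<close>, its only negative
      ones of high degree in \<open>p\<close>.\<close>
    also have "\<dots> = d - p ^ 4 * (6 * w - p) - 4 * p ^ 3 * (6 * w - p)"
      unfolding d_def q(1) by algebra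
    also have "\<dots> \<le> d"
    proof -
      have "0 \<le> p ^ 4 * (6 * w - p)" "0 \<le> 4 * p ^ 3 * (6 * w - p)"
        using True p by (auto intro!: mult_nonneg_nonneg)
      then show ?thesis by linarith
    qed
    \<comment> \<open>The factor \<open>w + 2 + p\<close>, which is \<open>n - w\<close>, splits off
      the discriminant.\<close>
    finally have "0 < (w + 2 + p) * d" using w p by simp
    also have "\<dots> = 4 * a * c - b\<^sup>2"
      unfolding a_def b_def c_def d_def by algebra
    finally show ?thesis using a by (intro quadratic_pos)
  next
    case False
    then obtain u where u: "p = 6 * w + u" "u \<ge> 0"
      by (metis add.commute diff_add_cancel diff_ge_0_iff_ge linorder_le_cases)
    \<comment> \<open>Minus the derivative of the quadratic at the right end
      \<open>s = w * r\<close>.\<close>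
    have "0 \<le> 15*q*u^2 + 60*q^2*u + 28*q^3 + u^3 + 545*q*u + 544*q^2 + 65*u^2 + 3052*q + 1226*u + 5296"
      using u(2) q(2) by (intro add_nonneg_nonneg mult_nonneg_nonneg zero_le_power) auto
    also have "\<dots> = - (2 * a * (w * r) + b)"
      unfolding a_def b_def r u(1) q(1) by algebra
    finally have "2 * a * (w * r) + b \<le> 0" by simp
    moreover have "a * s \<le> a * (w * r)" using a s by simp
    ultimately have "a * (s + w * r) + b \<le> 0" by (simp add: algebra_simps)
    then have "0 \<le> (s - w * r) * (a * (s + w * r) + b)"
      using s by (intro mult_nonpos_nonpos) auto
        moreover have "0 < 12*p*q^4 + 12*p^2*q^3 + 4*p^3*q^2 + 4*q^5 + 188*p*q^3 + 134*p^2*q^2 +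
        26*p^3*q + 80*q^4 + 1082*p*q^2 + 486*p^2*q + 42*p^3 + 628*q^3 + 2708*p*q + 574*p^2 + 2416*q^2 +
        2484*p + 4548*q + 3344"
      using p q(2) by (intro add_nonneg_pos add_nonneg_nonneg mult_nonneg_nonneg zero_le_power) auto
        moreover have "12*p*q^4 + 12*p^2*q^3 + 4*p^3*q^2 + 4*q^5 + 188*p*q^3 + 134*p^2*q^2 + 26*p^3*q +
        80*q^4 + 1082*p*q^2 + 486*p^2*q + 42*p^3 + 628*q^3 + 2708*p*q + 574*p^2 + 2416*q^2 + 2484*p +
        4548*q + 3344 = a * (w * r)\<^sup>2 + b * (w * r) + c"
      unfolding a_def b_def c_def r q(1) by algebra
        moreover have "a * s\<^sup>2 + b * s + c = (s - w * r) * (a * (s + w * r) + b) + (a * (w *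
        r)\<^sup>2 + b * (w * r) + c)"
      by algebra
    ultimately show ?thesis by linarith
  qed
  then show "0 < (n - w) * ((w * r + s)\<^sup>2 + 2 * (n - 3) * w * r\<^sup>2 + 2 * (n - 1) * (n - 2)
          - (n - 2) * (n + 1) * (w * r + s)) + 2 * (n - 3) * s\<^sup>2" using F by simp
qed (use assms in auto)

text \<open>The case \<open>n = 2k + 1\<close> with \<open>w = k + 1\<close> and
  \<open>r = k\<close>. The discriminant in \<open>s\<close> is negative from \<open>w = 5\<close>
  on; for \<open>w = 4\<close> the quadratic is negative at \<open>s = 2\<close>.\<close>

lemma criterion_odd:
  fixes n w r s Q :: real
  assumes w: "w \<ge> 5" and n: "n = 2 * w - 1" and r: "r = w - 1"
    and Q: "Q \<ge> w * r\<^sup>2 + s\<^sup>2 / (n - w)"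
  shows "criterion n (w * r + s) Q"
proof (rule criterionI)
  obtain q where q: "w = 5 + q" "q \<ge> 0" using w by (metis add.commute diff_add_cancel diff_ge_0_iff_ge)
  define a where "a = 5*w - 9"
  define b where "b = - 2*w^3 + 6*w^2 - 4*w"
  define c where "c = w^5 - 9*w^4 + 31*w^3 - 51*w^2 + 40*w - 12"
  have F: "(n - w) * ((w * r + s)\<^sup>2 + 2 * (n - 3) * w * r\<^sup>2 + 2 * (n - 1) * (n - 2)
          - (n - 2) * (n + 1) * (w * r + s)) + 2 * (n - 3) * s\<^sup>2 = a * s\<^sup>2 + b * s + c"
    unfolding a_def b_def c_def n r by algebra
  have "0 < 16*q^6 + 288*q^5 + 2092*q^4 + 7752*q^3 + 15100*q^2 + 13920*q + 4032"
    using q(2) by (intro add_nonneg_pos add_nonneg_nonneg mult_nonneg_nonneg zero_le_power) auto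
  also have "\<dots> = 4 * a * c - b\<^sup>2"
    unfolding a_def b_def c_def q(1) by algebra
  finally have "a * s\<^sup>2 + b * s + c > 0"
    using w by (intro quadratic_pos) (auto simp: a_def)
  then show "0 < (n - w) * ((w * r + s)\<^sup>2 + 2 * (n - 3) * w * r\<^sup>2 + 2 * (n - 1) * (n - 2)
          - (n - 2) * (n + 1) * (w * r + s)) + 2 * (n - 3) * s\<^sup>2" using F by simp
qed (use assms in auto)

text \<open>For \<open>w = 2\<close> the discriminant argument of \<open>criterion_even\<close>
  fails at \<open>p = 0\<close>, so the possible values of \<open>s = 2 * r - T\<close> are inserted
  one by one. At \<open>T = 2\<close>, \<open>p = 0\<close> the polynomial is \<open>- 32\<close>;
  that configuration is treated on its own.\<close>

lemma criterion_two:
  fixes n r T p Q :: real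
  assumes p: "p \<ge> 0" and n: "n = 6 + p" and r: "r = 3 + p"
    and T: "T = 0 \<or> T = 2 \<and> p \<ge> 1"
    and Q: "Q \<ge> 2 * r\<^sup>2 + (2 * r - T)\<^sup>2 / (n - 2)"
  shows "criterion n (2 * r + (2 * r - T)) Q"
proof (rule criterionI)
  let ?F = "(n - 2) * ((2 * r + (2 * r - T))\<^sup>2 + 2 * (n - 3) * 2 * r\<^sup>2 + 2 * (n - 1) * (n - 2)
          - (n - 2) * (n + 1) * (2 * r + (2 * r - T))) + 2 * (n - 3) * (2 * r - T)\<^sup>2"
  have F0: "?F = 6*p^3 + 42*p^2 + 84*p + 40" if "T = 0"
    unfolding n r that by algebra
  have F2: "?F = 8*p^3 + 40*p^2 + 32*p - 32" if "T = 2"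
    unfolding n r that by algebra
  show "0 < ?F"
    using T
  proof (elim disjE conjE)
    assume T: "T = 0"
    have "0 < 6*p^3 + 42*p^2 + 84*p + 40"
      using p by (intro add_nonneg_pos add_nonneg_nonneg mult_nonneg_nonneg zero_le_power) auto
    then show ?thesis using F0[OF T] by simp
  next
    assume T: "T = 2" "p \<ge> 1"
        obtain q where q: "p = 1 + q" "q \<ge> 0" using T(2) by (metis add.commute diff_add_cancel
        diff_ge_0_iff_ge)
    have "0 < 8*q^3 + 64*q^2 + 136*q + 48"
      using q(2) by (intro add_nonneg_pos add_nonneg_nonneg mult_nonneg_nonneg zero_le_power) auto
    also have "\<dots> = ?F" unfolding F2[OF T(1)] q(1) by algebra
    finally show ?thesis .
  qed
qed (use assms in auto)

text \<open>As for \<open>w = 2\<close>, with the four even values of \<open>T\<close> up to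
  \<open>6\<close>. At \<open>T = 6\<close>, \<open>p = 0\<close> the polynomial is
  \<open>- 60\<close>, which leaves order 8 as an exception.\<close>

lemma criterion_three:
  fixes n r T p Q :: real
  assumes p: "p \<ge> 0" and n: "n = 8 + p" and r: "r = 4 + p"
    and T: "T = 0 \<or> T = 2 \<or> T = 4 \<or> T = 6 \<and> p \<ge> 1"
    and Q: "Q \<ge> 3 * r\<^sup>2 + (3 * r - T)\<^sup>2 / (n - 3)"
  shows "criterion n (3 * r + (3 * r - T)) Q"
proof (rule criterionI)
  let ?F = "(n - 3) * ((3 * r + (3 * r - T))\<^sup>2 + 2 * (n - 3) * 3 * r\<^sup>2 + 2 * (n - 1) * (n - 2)
          - (n - 2) * (n + 1) * (3 * r + (3 * r - T))) + 2 * (n - 3) * (3 * r - T)\<^sup>2"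
  have F0: "?F = 20*p^3 + 210*p^2 + 682*p + 660" if "T = 0"
    unfolding n r that by algebra
  have F2: "?F = 22*p^3 + 202*p^2 + 520*p + 300" if "T = 2"
    unfolding n r that by algebra
  have F4: "?F = 24*p^3 + 194*p^2 + 382*p + 60" if "T = 4"
    unfolding n r that by algebra
  have F6: "?F = 26*p^3 + 186*p^2 + 268*p - 60" if "T = 6"
    unfolding n r that by algebra
  show "0 < ?F"
    using T
  proof (elim disjE conjE)
    assume T: "T = 0"
    have "0 < 20*p^3 + 210*p^2 + 682*p + 660"
      using p by (intro add_nonneg_pos add_nonneg_nonneg mult_nonneg_nonneg zero_le_power) auto
    then show ?thesis using F0[OF T] by simp
  next
    assume T: "T = 2"
    have "0 < 22*p^3 + 202*p^2 + 520*p + 300"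
      using p by (intro add_nonneg_pos add_nonneg_nonneg mult_nonneg_nonneg zero_le_power) auto
    then show ?thesis using F2[OF T] by simp
  next
    assume T: "T = 4"
    have "0 < 24*p^3 + 194*p^2 + 382*p + 60"
      using p by (intro add_nonneg_pos add_nonneg_nonneg mult_nonneg_nonneg zero_le_power) auto
    then show ?thesis using F4[OF T] by simp
  next
    assume T: "T = 6" "p \<ge> 1"
        obtain q where q: "p = 1 + q" "q \<ge> 0" using T(2) by (metis add.commute diff_add_cancel
        diff_ge_0_iff_ge)
    have "0 < 26*q^3 + 264*q^2 + 718*q + 420"
      using q(2) by (intro add_nonneg_pos add_nonneg_nonneg mult_nonneg_nonneg zero_le_power) auto
    also have "\<dots> = ?F" unfolding F6[OF T(1)] q(1) by algebra
    finally show ?thesis .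
  qed
qed (use assms in auto)

section \<open>Hamilton paths as arrangements\<close>

lemma set_vwalk_arcs_nth:
  "set (vwalk_arcs xs) = {(xs ! i, xs ! Suc i) | i. Suc i < length xs}"
proof (induction xs rule: vwalk_arcs.induct)
  case (3 x y zs)
  have "{((x # y # zs) ! i, (x # y # zs) ! Suc i) | i. Suc i < length (x # y # zs)} =
      insert (x, y) {((y # zs) ! i, (y # zs) ! Suc i) | i. Suc i < length (y # zs)}" (is "?L = ?R")
  proof (intro equalityI subsetI)
    fix e assume "e \<in> ?L"
    then obtain i where "e = ((x # y # zs) ! i, (x # y # zs) ! Suc i)" "Suc i < length (x # y # zs)" by blast
    then show "e \<in> ?R" by (cases i) auto
  next
    fix e assume "e \<in> ?R"
    then consider "e = (x, y)" | i where "e = ((y # zs) ! i, (y # zs) ! Suc i)" "Suc i < length (y # zs)" by blast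
    then show "e \<in> ?L"
    proof cases
      case 1
      then show ?thesis by (intro CollectI exI[of _ 0]) auto
    next
      case 2
      then show ?thesis by (intro CollectI exI[of _ "Suc i"]) auto
    qed
  qed
  then show ?case using 3 by simp
qed auto

definition ham_lists :: "'a set \<Rightarrow> 'a rel \<Rightarrow> 'a list set" where
  "ham_lists V E = {xs \<in> permutations_of_set V. set (vwalk_arcs xs) \<subseteq> E}"

definition no_ham_cycle :: "'a set \<Rightarrow> 'a rel \<Rightarrow> bool" where
  "no_ham_cycle V E \<longleftrightarrow> (\<forall>xs\<in>ham_lists V E. (last xs, hd xs) \<notin> E)"

lemma ham_listsD:
  assumes "xs \<in> ham_lists V E"
  shows "distinct xs" "set xs = V" "length xs = card V"
    and "\<And>i. Suc i < card V \<Longrightarrow> (xs ! i, xs ! Suc i) \<in> E"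
  using assms by (force simp: ham_lists_def permutations_of_set_def set_vwalk_arcs_nth distinct_card)+

lemma ham_listsI:
  assumes "distinct xs" "set xs = V" "\<And>i. Suc i < card V \<Longrightarrow> (xs ! i, xs ! Suc i) \<in> E"
  shows "xs \<in> ham_lists V E"
  using assms by (auto simp: ham_lists_def permutations_of_set_def set_vwalk_arcs_nth distinct_card)

lemma finite_ham_lists: "finite V \<Longrightarrow> finite (ham_lists V E)"
  by (auto simp: ham_lists_def)

lemma no_ham_cycleD:
  assumes "no_ham_cycle V E" "xs \<in> ham_lists V E" "V \<noteq> {}"
  shows "(xs ! (card V - 1), xs ! 0) \<notin> E"
proof -
  have "xs \<noteq> []" using ham_listsD(2)[OF assms(2)] assms(3) by auto
  then show ?thesis
    using assms(1,2) ham_listsD(3)[OF assms(2)]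
    by (auto simp: no_ham_cycle_def last_conv_nth hd_conv_nth)
qed

text \<open>If different rotations agreed, \<open>xs\<close> would be a proper rotation of
  \<open>ys\<close>. The last and first entries of \<open>ys\<close> would then be consecutive in
  \<open>xs\<close>, hence adjacent, and would close \<open>ys\<close> to a Hamilton cycle.\<close>

lemma rotate_ham_lists_inj:
  assumes "no_ham_cycle V E" "xs \<in> ham_lists V E" "ys \<in> ham_lists V E"
    and eq: "rotate r xs = rotate s ys" and le: "r \<le> s" "s < card V"
  shows "r = s \<and> xs = ys"
proof -
  let ?n = "card V"
  have len: "length xs = ?n" "length ys = ?n" using ham_listsD assms by blast+
  have "rotate (?n - r) (rotate r xs) = xs"
    using len le by (simp add: rotate_rotate)
  moreover have "rotate (?n - r) (rotate s ys) = rotate (s - r) (rotate ?n ys)"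
    using le by (simp add: rotate_rotate add.commute)
  ultimately have xs: "xs = rotate (s - r) ys"
    using eq len by simp
  show ?thesis
  proof (cases "r = s")
    case False
    define t where "t = s - r"
    have t: "0 < t" "t < ?n" using False le by (auto simp: t_def)
    have 1: "xs ! (?n - 1 - t) = ys ! (?n - 1)"
      using xs t len by (simp add: t_def[symmetric] nth_rotate)
    have 2: "xs ! Suc (?n - 1 - t) = ys ! 0"
      using xs t len by (simp add: t_def[symmetric] nth_rotate Suc_diff_Suc)
    have "(xs ! (?n - 1 - t), xs ! Suc (?n - 1 - t)) \<in> E"
      using ham_listsD(4)[OF assms(2)] t by simp
    moreover have "V \<noteq> {}" using t by auto
    ultimately show ?thesis using no_ham_cycleD[OF assms(1,3)] 1 2 by simp
  qed (use xs in simp)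
qed

context edge_count begin

text \<open>Only the one cyclic position where the end of \<open>xs\<close> meets its beginning can
  carry a marked pair.\<close>

lemma X_rotate_le:
  assumes xs: "xs \<in> ham_lists V E" and H: "\<And>x y. H x y \<Longrightarrow> (x, y) \<notin> E"
  shows "X (rotate r xs) \<le> 1"
proof -
  have len: "length xs = n" using ham_listsD[OF xs] by simp
  have le: "i = j" if "i < n" "j < n" "(r + i) mod n = (r + j) mod n" "i \<le> j" for i j
  proof -
    have "n dvd (r + j) - (r + i)"
      using that by (metis mod_eq_dvd_iff_nat nat_add_left_cancel_le)
    then show ?thesis using that by (auto dest: dvd_imp_le)
  qed
  have inj: "i = j" if "i < n" "j < n" "(r + i) mod n = (r + j) mod n" for i j
    using le[of i j] le[of j i] that by (cases "i \<le> j") auto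
  let ?A = "{i \<in> {..<n}. H (rotate r xs ! i) (rotate r xs ! sc i)}"
  have last: "(r + i) mod n = n - 1" if "i \<in> ?A" for i
  proof (rule ccontr)
    assume ne: "(r + i) mod n \<noteq> n - 1"
    have i: "i < n" using that by auto
    have "(r + i) mod n < n" using i by simp
    then have lt: "Suc ((r + i) mod n) < n" using ne by linarith
    have "(r + sc i) mod n = Suc (r + i) mod n" by (simp add: sc_def mod_simps)
    also have "\<dots> = Suc ((r + i) mod n)" using lt by (simp add: mod_Suc)
    finally have "(r + sc i) mod n = Suc ((r + i) mod n)" .
    then have "H (xs ! ((r + i) mod n)) (xs ! Suc ((r + i) mod n))"
      using that i sc_less[of i] len by (auto simp: nth_rotate)
    then show False using H ham_listsD(4)[OF xs lt] by blast
  qed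
  have "\<forall>i\<in>?A. \<forall>j\<in>?A. i = j"
  proof (intro ballI)
    fix i j assume "i \<in> ?A" "j \<in> ?A"
    then show "i = j" using last[of i] last[of j] by - (rule inj, auto)
  qed
  moreover have "finite ?A" by simp
  ultimately show ?thesis
    unfolding X_def One_nat_def by (rule iffD2[OF card_le_Suc0_iff_eq, rotated])
qed

lemma card_ham_lists_le_low:
  assumes "no_ham_cycle V E" and H: "\<And>x y. H x y \<Longrightarrow> (x, y) \<notin> E"
  shows "n * card (ham_lists V E) \<le> card low"
proof -
  let ?f = "\<lambda>(r, xs). rotate r xs :: 'a list"
  have "inj_on ?f ({..<n} \<times> ham_lists V E)"
  proof (rule inj_onI, clarify)
    fix r s xs ys
    assume *: "r < n" "xs \<in> ham_lists V E" "s < n" "ys \<in> ham_lists V E" "rotate r xs = rotate s ys"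
    show "r = s \<and> xs = ys"
      using rotate_ham_lists_inj[OF assms(1) *(2,4,5)] rotate_ham_lists_inj[OF assms(1) *(4,2) *(5)[symmetric]] *(1,3)
      by (cases "r \<le> s") auto
  qed
  moreover have "?f ` ({..<n} \<times> ham_lists V E) \<subseteq> low"
    using X_rotate_le[of _ E] H by (auto simp: low_def permutations_of_set_def ham_listsD)
  moreover have "finite low" using finV by (simp add: low_def)
  ultimately have "card ({..<n} \<times> ham_lists V E) \<le> card low"
    by (rule card_inj_on_le)
  then show ?thesis by (simp add: card_cartesian_product)
qed

lemma card_ham_lists_less:
  assumes "no_ham_cycle V E" and "\<And>x y. H x y \<Longrightarrow> (x, y) \<notin> E"
    and "real (card low) < 2 * real n * fact (n - 2)" 
  shows "card (ham_lists V E) < 2 * fact (n - 2)"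
proof -
  have "real (n * card (ham_lists V E)) < 2 * real n * fact (n - 2)"
    using card_ham_lists_le_low[OF assms(1,2)] assms(3) by (meson le_less_trans of_nat_le_iff)
  then have "real n * real (card (ham_lists V E)) < real n * (2 * fact (n - 2))" by simp
  then have "real (card (ham_lists V E)) < 2 * fact (n - 2)"
    using mult_less_cancel_left_pos by (metis mult_zero_left of_nat_0_le_iff order_less_le)
  also have "\<dots> = real (2 * fact (n - 2))" by simp
  finally show ?thesis by linarith
qed

end

section \<open>Posa's theorem\<close>

text \<open>In the cyclic form no position is special, so a Hamilton cycle can be cut open at any of
  its arcs.\<close>

lemma no_ham_cycle_iff:
  assumes "V \<noteq> {}" "finite V"
  shows "no_ham_cycle V E \<longleftrightarrow>
    \<not> (\<exists>xs\<in>permutations_of_set V. \<forall>i<card V. (xs ! i, xs ! (Suc i mod card V)) \<in> E)"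
proof -
  have n: "card V > 0" using assms by auto
  have "xs \<in> ham_lists V E \<and> (last xs, hd xs) \<in> E \<longleftrightarrow>
      xs \<in> permutations_of_set V \<and> (\<forall>i<card V. (xs ! i, xs ! (Suc i mod card V)) \<in> E)" for xs
  proof (cases "xs \<in> permutations_of_set V")
    case True
    then have xs: "distinct xs" "set xs = V" "length xs = card V"
      by (auto simp: permutations_of_set_def distinct_card)
    then have "xs \<noteq> []" using n by auto
    then have *: "(last xs, hd xs) = (xs ! (card V - 1), xs ! 0)"
      using xs by (simp add: last_conv_nth hd_conv_nth)
    have "xs \<in> ham_lists V E \<longleftrightarrow> (\<forall>i. Suc i < card V \<longrightarrow> (xs ! i, xs ! Suc i) \<in> E)"
      using ham_listsD(4) ham_listsI xs by blast
    moreover have "(\<forall>i<card V. (xs ! i, xs ! (Suc i mod card V)) \<in> E) \<longleftrightarrow>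
       (\<forall>i. Suc i < card V \<longrightarrow> (xs ! i, xs ! Suc i) \<in> E) \<and> (xs ! (card V - 1), xs ! 0) \<in> E" (is "?L \<longleftrightarrow> ?R")
    proof
      assume L: ?L
      have "(xs ! i, xs ! Suc i) \<in> E" if "Suc i < card V" for i
        using L[rule_format, of i] that by simp
      moreover have "(xs ! (card V - 1), xs ! 0) \<in> E"
        using L[rule_format, of "card V - 1"] n by simp
      ultimately show ?R by blast
    next
      assume R: ?R
      show ?L
      proof (intro allI impI)
        fix i assume "i < card V"
        then show "(xs ! i, xs ! (Suc i mod card V)) \<in> E"
          using R by (cases "Suc i = card V") (auto simp: eq_diff_iff dest!: arg_cong[of "Suc i" _ "\<lambda>k. k - 1"])
      qed
    qed
    ultimately show ?thesis using True * by simp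
  qed (auto simp: ham_lists_def)
  then show ?thesis unfolding no_ham_cycle_def by blast
qed

text \<open>On at least three vertices a cycle does not return along the arc just used; this keeps
  an added edge from being traversed in both directions.\<close>

lemma mod_Suc_neq:
  assumes "i < n" "3 \<le> (n :: nat)"
  shows "Suc (Suc i mod n) mod n \<noteq> i"
  using assms by (cases "Suc i = n"; cases "Suc (Suc i) = n") auto

text \<open>A Hamilton cycle of the larger graph must use the new edge, and exactly once; cutting it
  there leaves the path.\<close>

lemma ham_path_of_cycle:
  assumes V: "finite V" "3 \<le> card V" and "sym F"
    and F: "no_ham_cycle V F" "\<not> no_ham_cycle V (F \<union> {(u, v), (v, u)})"
  shows "\<exists>ys\<in>ham_lists V F. ys ! 0 = u \<and> ys ! (card V - 1) = v"
proof -
  let ?n = "card V" and ?F = "F \<union> {(u, v), (v, u)}"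
  have ne: "V \<noteq> {}" using V by auto
  obtain xs where xs: "xs \<in> permutations_of_set V" "\<And>i. i < ?n \<Longrightarrow> (xs ! i, xs ! (Suc i mod ?n)) \<in> ?F"
    using F(2) no_ham_cycle_iff[OF ne V(1), of ?F] by blast
  obtain i where i: "i < ?n" "(xs ! i, xs ! (Suc i mod ?n)) \<notin> F"
    using F(1) no_ham_cycle_iff[OF ne V(1), of F] xs(1) by blast
  have d: "distinct xs" "set xs = V" and len: "length xs = ?n"
    using xs(1) by (auto simp: permutations_of_set_def distinct_card)
  \<comment> \<open>This moves the new arc, at position \<open>i\<close>, to the wrap-around
    place.\<close>
  define ys where "ys = rotate (Suc i) xs"
  have ys: "ys ! j = xs ! ((Suc i + j) mod ?n)" if "j < ?n" for j
    using that len unfolding ys_def by (subst nth_rotate) simp_all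
  have ysF: "ys \<in> ham_lists V F"
  proof (rule ham_listsI)
    fix j assume j: "Suc j < ?n"
    define m where "m = (Suc i + j) mod ?n"
    have m: "m < ?n" using i by (simp add: m_def)
    have mi: "m \<noteq> i"
    proof (cases "Suc i + j < ?n")
      case False
      then have "m = Suc i + j - ?n" using i j by (simp add: m_def le_mod_geq)
      then show ?thesis using j False by linarith
    qed (simp add: m_def)
    have e: "(ys ! j, ys ! Suc j) = (xs ! m, xs ! (Suc m mod ?n))"
      using j ys[of j] ys[of "Suc j"] by (simp add: m_def mod_simps)
    show "(ys ! j, ys ! Suc j) \<in> F"
    proof (rule ccontr)
      assume "(ys ! j, ys ! Suc j) \<notin> F"
      then have "{xs ! m, xs ! (Suc m mod ?n)} = {u, v}"
        using xs(2)[OF m] unfolding e by auto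
      moreover have "{xs ! i, xs ! (Suc i mod ?n)} = {u, v}"
        using xs(2)[OF i(1)] i(2) by auto
      ultimately have "xs ! m = xs ! i \<or> xs ! m = xs ! (Suc i mod ?n) \<and> xs ! (Suc m mod ?n) = xs ! i"
        by (auto simp: doubleton_eq_iff)
      then have "m = i \<or> m = Suc i mod ?n \<and> Suc m mod ?n = i"
        using d(1) len m i(1) nth_eq_iff_index_eq[of xs] by (metis bot_nat_0.extremum_strict mod_less_divisor not_gr_zero)
      then show False using mi mod_Suc_neq[OF i(1) V(2)] by auto
    qed
  qed (use d in \<open>auto simp: ys_def\<close>)
  have e: "ys ! 0 = xs ! (Suc i mod ?n)" "ys ! (?n - 1) = xs ! i"
    using ys[of 0] ys[of "?n - 1"] V i by auto
  from xs(2)[OF i(1)] i(2) consider "xs ! i = u" "xs ! (Suc i mod ?n) = v" | "xs ! i = v" "xs ! (Suc i mod ?n) = u"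
    by auto
  then show ?thesis
  proof cases
    case 2
    then show ?thesis using ysF e by auto
  next
    \<comment> \<open>The cycle crosses the new edge from \<open>u\<close> to \<open>v\<close>, so
      \<open>ys\<close> runs from \<open>v\<close> to \<open>u\<close> and has to be
      reversed.\<close>
    case 1
    have "rev ys \<in> ham_lists V F"
    proof (rule ham_listsI)
      fix j assume j: "Suc j < ?n"
      have "(ys ! (?n - Suc (Suc j)), ys ! Suc (?n - Suc (Suc j))) \<in> F"
        using ham_listsD(4)[OF ysF] j by simp
      moreover have "Suc (?n - Suc (Suc j)) = ?n - Suc j" using j by simp
      ultimately show "(rev ys ! j, rev ys ! Suc j) \<in> F"
        using \<open>sym F\<close> j ham_listsD(3)[OF ysF] by (simp add: rev_nth symD)
    qed (use ham_listsD[OF ysF] in auto)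
    moreover have "rev ys ! 0 = u" "rev ys ! (?n - 1) = v"
      using 1 e V ham_listsD(3)[OF ysF] by (auto simp: rev_nth)
    ultimately show ?thesis by blast
  qed
qed

text \<open>Otherwise, reverse the part of the path behind position \<open>i\<close>: one of the two
  edges joins the pieces, the other closes the cycle.\<close>

lemma no_crossing:
  assumes nh: "no_ham_cycle V F" and "sym F" and ys: "ys \<in> ham_lists V F" and i: "Suc i < card V"
    and e: "(ys ! 0, ys ! Suc i) \<in> F"
  shows "(ys ! i, ys ! (card V - 1)) \<notin> F"
proof
  let ?n = "card V"
  assume e2: "(ys ! i, ys ! (?n - 1)) \<in> F"
  have len: "length ys = ?n" using ham_listsD[OF ys] by blast
  define zs where "zs = take (Suc i) ys @ rev (drop (Suc i) ys)"
  have zs_nth: "zs ! j = (if j \<le> i then ys ! j else ys ! (?n + i - j))" if "j < ?n" for j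
    using that i len by (auto simp: zs_def nth_append rev_nth less_Suc_eq_le intro!: arg_cong[of _ _ "(!) ys"])
  have "zs \<in> ham_lists V F"
  proof (rule ham_listsI)
    show "distinct zs" "set zs = V"
    proof -
      have "mset zs = mset ys"
        unfolding zs_def by (metis append_take_drop_id mset_append mset_rev)
      then show "distinct zs" "set zs = V"
        using ham_listsD[OF ys] by (metis mset_eq_imp_distinct_iff, metis mset_eq_setD)
    qed
    fix j assume j: "Suc j < ?n"
    consider "j < i" | "j = i" | "j > i" by linarith
    then show "(zs ! j, zs ! Suc j) \<in> F"
    proof cases
      case 1
      then show ?thesis using j zs_nth ham_listsD(4)[OF ys j] by simp
    next
      case 2
      then show ?thesis using j zs_nth e2 by simp
    next
      case 3
      then have "Suc (?n + i - Suc j) = ?n + i - j" using j by simp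
      moreover have "(ys ! (?n + i - Suc j), ys ! Suc (?n + i - Suc j)) \<in> F"
        using 3 j by (intro ham_listsD(4)[OF ys]) simp
      ultimately show ?thesis using 3 j zs_nth \<open>sym F\<close> by (simp add: symD)
    qed
  qed
  moreover have "V \<noteq> {}" using i by auto
  ultimately have "(zs ! (?n - 1), zs ! 0) \<notin> F" using no_ham_cycleD[OF nh] by blast
  moreover have "zs ! (?n - 1) = ys ! Suc i" "zs ! 0 = ys ! 0" using zs_nth i by auto
  ultimately show False using e \<open>sym F\<close> by (simp add: symD)
qed

definition deg :: "'a rel \<Rightarrow> 'a \<Rightarrow> nat" where "deg E x = card (E `` {x})"

lemma deg_mono: "finite V \<Longrightarrow> F \<subseteq> V \<times> V \<Longrightarrow> E \<subseteq> F \<Longrightarrow> deg E x \<le> deg F x"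
  unfolding deg_def by (intro card_mono) (auto intro: finite_subset[of _ V])

lemma complete_has_ham_cycle:
  assumes V: "finite V" "3 \<le> card V" and F: "\<And>x y. x \<in> V \<Longrightarrow> y \<in> V \<Longrightarrow> x \<noteq> y \<Longrightarrow> (x, y) \<in> F"
  shows "\<not> no_ham_cycle V F"
proof -
  have ne: "V \<noteq> {}" using V by auto
  obtain xs where xs: "set xs = V" "distinct xs" using finite_distinct_list[OF V(1)] by blast
  then have len: "length xs = card V" by (auto simp: distinct_card)
  have "(xs ! i, xs ! (Suc i mod card V)) \<in> F" if i: "i < card V" for i
  proof (rule F)
    have j: "Suc i mod card V < card V" using i by (intro mod_less_divisor) simp
    show "xs ! i \<in> V" "xs ! (Suc i mod card V) \<in> V" using xs len i j by auto
    have "Suc i mod card V \<noteq> i" using i V by (cases "Suc i = card V") auto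
    then show "xs ! i \<noteq> xs ! (Suc i mod card V)" using xs len i j by (simp add: nth_eq_iff_index_eq)
  qed
  then show ?thesis
    using xs unfolding no_ham_cycle_iff[OF ne V(1)] permutations_of_set_def by blast
qed

text \<open>In an edge-maximal nonhamiltonian supergraph \<open>F\<close>, take nonadjacent
  \<open>u\<close>, \<open>v\<close> of maximal degree sum with
  \<open>deg F u \<le> deg F v\<close>, and put \<open>k = deg F u\<close>. They are the ends of a
  Hamilton path, on which the predecessors of the neighbours of \<open>u\<close> are
  \<open>k\<close> vertices not adjacent to \<open>v\<close>, hence of degree at most
  \<open>k\<close>. For \<open>n = 2k + 1\<close> also \<open>v\<close> has degree at most
  \<open>k\<close>, and this extra vertex is needed for the estimates later.\<close>

lemma posa:
  assumes V: "finite V" "3 \<le> card V" and E: "E \<subseteq> V \<times> V" "sym E" "irrefl E" and nh: "no_ham_cycle V E"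
  shows "(\<exists>u\<in>V. deg E u \<le> 1) \<or> (\<exists>k W. 2 \<le> k \<and> W \<subseteq> V \<and> (\<forall>x\<in>W. deg E x \<le> k) \<and>
     (2 * k + 2 \<le> card V \<and> card W = k \<or> card V = 2 * k + 1 \<and> card W = k + 1))"
proof -
  let ?n = "card V"
  let ?A = "{F. E \<subseteq> F \<and> F \<subseteq> V \<times> V \<and> sym F \<and> irrefl F \<and> no_ham_cycle V F}"
  have "finite ?A"
    by (rule finite_subset[of _ "Pow (V \<times> V)"]) (use V in auto)
  then obtain F where F: "F \<in> ?A" and max: "\<And>F'. F' \<in> ?A \<Longrightarrow> F \<subseteq> F' \<Longrightarrow> F = F'"
    using finite_has_maximal2[of ?A E] E nh by (auto 4 4)
  have symF: "sym F" and irrF: "irrefl F" and FV: "F \<subseteq> V \<times> V" and nhF: "no_ham_cycle V F" and EF: "E \<subseteq> F"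
    using F by auto
  let ?N = "{(x, y). x \<in> V \<and> y \<in> V \<and> x \<noteq> y \<and> (x, y) \<notin> F}"
  have "finite ?N" by (rule finite_subset[of _ "V \<times> V"]) (use V in auto)
  moreover have "?N \<noteq> {}" using complete_has_ham_cycle[OF V, of F] nhF by auto
  ultimately obtain p where "p \<in> ?N" and pmax: "\<And>q. q \<in> ?N \<Longrightarrow> deg F (fst q) + deg F (snd q) \<le> deg F (fst p) + deg F (snd p)"
    using finite_has_maximal[of "(\<lambda>(x, y). deg F x + deg F y) ` ?N"]
    by (smt (verit, best) Max_ge Max_in case_prod_unfold finite_imageI imageE image_is_empty rev_image_eqI)
  have "\<exists>u v. u \<in> V \<and> v \<in> V \<and> u \<noteq> v \<and> (u, v) \<notin> F \<and> deg F u \<le> deg F v \<and>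
      (\<forall>x y. x \<in> V \<longrightarrow> y \<in> V \<longrightarrow> x \<noteq> y \<longrightarrow> (x, y) \<notin> F \<longrightarrow> deg F x + deg F y \<le> deg F u + deg F v)"
  proof (cases "deg F (fst p) \<le> deg F (snd p)")
    case True
    then show ?thesis using \<open>p \<in> ?N\<close> pmax by (intro exI[of _ "fst p"] exI[of _ "snd p"]) auto
  next
    case False
    then show ?thesis using \<open>p \<in> ?N\<close> pmax symF
      by (intro exI[of _ "snd p"] exI[of _ "fst p"]) (auto simp: add.commute dest: symD)
  qed
  then obtain u v where uv: "u \<in> V" "v \<in> V" "u \<noteq> v" "(u, v) \<notin> F" "deg F u \<le> deg F v"
    and opt: "\<And>x y. x \<in> V \<Longrightarrow> y \<in> V \<Longrightarrow> x \<noteq> y \<Longrightarrow> (x, y) \<notin> F \<Longrightarrow> deg F x + deg F y \<le> deg F u + deg F v"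
    by blast
  have "\<not> no_ham_cycle V (F \<union> {(u, v), (v, u)})"
  proof
    assume "no_ham_cycle V (F \<union> {(u, v), (v, u)})"
    moreover have "sym (F \<union> {(u, v), (v, u)})" using symF by (auto simp: sym_def)
    moreover have "irrefl (F \<union> {(u, v), (v, u)})" using irrF uv by (auto simp: irrefl_def)
    ultimately have "F = F \<union> {(u, v), (v, u)}" using EF FV uv by (intro max) auto
    then show False using uv by blast
  qed
  then obtain ys where ys: "ys \<in> ham_lists V F" "ys ! 0 = u" "ys ! (?n - 1) = v"
    using ham_path_of_cycle[OF V symF nhF] by blast
  define k where "k = deg F u"
  define I where "I = {i. Suc i < ?n \<and> (u, ys ! Suc i) \<in> F}"
  \<comment> \<open>The indices in \<open>I\<close> are one less than those of the neighbours of
    \<open>u\<close>, so \<open>W\<close> consists of their predecessors.\<close>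
  define W where "W = (!) ys ` I"
  have len: "length ys = ?n" "distinct ys" "set ys = V" using ham_listsD[OF ys(1)] by auto
  have finI: "finite I" by (rule finite_subset[of _ "{..<?n}"]) (auto simp: I_def)
  have "F `` {u} = (\<lambda>i. ys ! Suc i) ` I"
  proof (intro equalityI subsetI)
    fix x assume x: "x \<in> F `` {u}"
    then have "x \<in> set ys" using FV len by auto
    then obtain j where j: "j < ?n" "x = ys ! j" using len by (auto simp: in_set_conv_nth)
    have "j \<noteq> 0" using x j ys(2) irrF by (auto simp: irrefl_def intro: ccontr)
    then show "x \<in> (\<lambda>i. ys ! Suc i) ` I" using x j by (intro image_eqI[of _ _ "j - 1"]) (auto simp: I_def)
  qed (auto simp: I_def)
  moreover have "inj_on (\<lambda>i. ys ! Suc i) I" using len by (auto simp: inj_on_def I_def nth_eq_iff_index_eq)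
  ultimately have cI: "card I = k" by (simp add: k_def deg_def card_image)
  have "inj_on ((!) ys) I" using len by (auto simp: inj_on_def I_def nth_eq_iff_index_eq)
  then have cW: "card W = k" using cI by (simp add: W_def card_image)
  have WV: "W \<subseteq> V" using len by (auto simp: W_def I_def)
  have finW: "finite W" using finI by (simp add: W_def)
  have vW: "v \<notin> W"
  proof
    assume "v \<in> W"
    then obtain i where "Suc i < ?n" "ys ! i = ys ! (?n - 1)" using ys by (auto simp: W_def I_def)
    then show False using len by (simp add: nth_eq_iff_index_eq)
  qed
  have Wv: "(w, v) \<notin> F" if "w \<in> W" for w
    using that no_crossing[OF nhF symF ys(1)] ys by (auto simp: W_def I_def)
  have Wdeg: "deg F w \<le> k" if "w \<in> W" for w
    using opt[of w v] that WV uv vW Wv[OF that] by (auto simp: k_def)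
  have "F `` {v} \<subseteq> V - insert v W"
    using FV Wv symF irrF by (auto dest: symD simp: irrefl_def)
  then have "deg F v \<le> card (V - insert v W)"
    unfolding deg_def using V by (intro card_mono) auto
  \<comment> \<open>The vertex \<open>v\<close> is excluded in addition to the \<open>k\<close>
    vertices of \<open>W\<close>.\<close>
  also have "\<dots> = ?n - (k + 1)"
    using V WV uv vW finW cW by (subst card_Diff_subset) auto
  finally have dv: "deg F v \<le> ?n - (k + 1)" .
  have dEF: "deg E x \<le> deg F x" for x using deg_mono[OF V(1) FV EF] .
  have WdegE: "deg E x \<le> k" if "x \<in> W" for x
    using le_trans[OF dEF Wdeg[OF that]] .
  show ?thesis
  proof (cases "k \<le> 1")
    case True
    then show ?thesis using dEF[of u] uv by (auto simp: k_def intro!: bexI[of _ u])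
  next
    case False
    show ?thesis
    proof (cases "2 * k + 2 \<le> ?n")
      case True
      then show ?thesis using False WV WdegE cW
        by (intro disjI2 exI[of _ k] exI[of _ W]) (auto intro: le_trans)
    next
      case small: False
      \<comment> \<open>From \<open>k \<le> deg F v \<le> n - k - 1\<close> and
        \<open>n < 2k + 2\<close> only \<open>n = 2k + 1\<close> remains.\<close>
      have "?n = 2 * k + 1" "deg F v \<le> k"
        using dv uv(5) V small by (auto simp: k_def)
      moreover have "card (insert v W) = k + 1" using vW finW cW by simp
      ultimately show ?thesis using False WV WdegE le_trans[OF dEF[of v]] uv
        by (intro disjI2 exI[of _ k] exI[of _ "insert v W"]) (auto intro: le_trans)
    qed
  qed
qed

section \<open>Marking non-edges at vertices of small degree\<close>

text \<open>A new vertex contributes its pairs in both orientations. Parity leaves only a few values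
  of \<open>T\<close> in the small cases.\<close>

lemma even_card_sym_irrefl:
  assumes "finite W" "sym R" "irrefl R"
  shows "even (card (R \<inter> W \<times> W))"
  using assms(1)
proof (induction W rule: finite_induct)
  case (insert x W)
  let ?A = "R `` {x} \<inter> W"
  have "R \<inter> insert x W \<times> insert x W = (R \<inter> W \<times> W) \<union> (Pair x ` ?A \<union> (\<lambda>y. (y, x)) ` ?A)"
    using assms(2,3) by (auto simp: irrefl_def dest: symD)
  moreover have "card \<dots> = card (R \<inter> W \<times> W) + card (Pair x ` ?A \<union> (\<lambda>y. (y, x)) ` ?A)"
    using insert by (intro card_Un_disjoint) auto
  moreover have "card (Pair x ` ?A \<union> (\<lambda>y. (y, x)) ` ?A) = card (Pair x ` ?A) + card ((\<lambda>y. (y, x)) ` ?A)"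
    using insert by (intro card_Un_disjoint) auto
  moreover have "card (Pair x ` ?A) = card ?A" "card ((\<lambda>y. (y, x)) ` ?A) = card ?A"
    by (auto intro!: card_image simp: inj_on_def)
  ultimately have "card (R \<inter> insert x W \<times> insert x W) = card (R \<inter> W \<times> W) + 2 * card ?A" by simp
  then show ?case using insert by simp
qed auto

text \<open>Choices made at two vertices of \<open>W\<close> could interfere and spoil the exact
  degree \<open>r\<close>. Therefore each \<open>B x\<close> contains all non-neighbours of
  \<open>x\<close> inside \<open>W\<close>, which makes the choices symmetric there;
  \<open>card W \<le> r + 1\<close> leaves room for this.\<close>

lemma exists_nonedges:
  assumes V: "finite V" "W \<subseteq> V" and E: "E \<subseteq> V \<times> V" "sym E" "irrefl E"
    and deg: "\<And>x. x \<in> W \<Longrightarrow> deg E x + r + 1 \<le> card V" and W: "card W \<le> r + 1"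
  shows "\<exists>H. (\<forall>x y. H x y \<longrightarrow> H y x) \<and> (\<forall>x. \<not> H x x) \<and> (\<forall>x y. H x y \<longrightarrow> (x, y) \<notin> E) \<and>
    (\<forall>x y. H x y \<longrightarrow> x \<in> W \<or> y \<in> W) \<and> (\<forall>x\<in>W. card {y\<in>V. H x y} = r)"
proof -
  define N where "N x = V - insert x (E `` {x})" for x
  have "\<exists>B. N x \<inter> W \<subseteq> B \<and> B \<subseteq> N x \<and> card B = r" if x: "x \<in> W" for x
  proof -
    have "x \<notin> E `` {x}" using E(3) by (auto simp: irrefl_def)
    moreover have "finite (E `` {x})" using V E by (auto intro: finite_subset[of _ V])
    ultimately have "card (insert x (E `` {x})) = deg E x + 1" by (simp add: deg_def)
    moreover have "card (N x) = card V - card (insert x (E `` {x}))"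
      unfolding N_def using V E x by (intro card_Diff_subset) (auto intro: finite_subset[of _ V])
    ultimately have "r \<le> card (N x)" using deg[OF x] by simp
    moreover have "card (N x \<inter> W) \<le> card (W - {x})"
      using V by (intro card_mono) (auto simp: N_def intro: finite_subset)
    then have "card (N x \<inter> W) \<le> r" using W x V by (simp add: finite_subset)
    ultimately show ?thesis
      using V by (intro exists_subset_between) (auto simp: N_def)
  qed
  then obtain B where B: "\<And>x. x \<in> W \<Longrightarrow> N x \<inter> W \<subseteq> B x \<and> B x \<subseteq> N x \<and> card (B x) = r" by metis
  define H where "H x y \<longleftrightarrow> x \<in> W \<and> y \<in> B x \<or> y \<in> W \<and> x \<in> B y" for x y
  have "{y \<in> V. H x y} = B x" if x: "x \<in> W" for x
  proof -
    have "y \<in> B x" if "y \<in> W" "x \<in> B y" for y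
    proof -
      have "x \<in> N y" using B that by blast
      then have "y \<in> N x" using E(2) V(2) that by (auto simp: N_def dest: symD)
      then show ?thesis using B[OF x] that by blast
    qed
    moreover have "B x \<subseteq> V" using B[OF x] by (auto simp: N_def)
    ultimately show ?thesis using x by (auto simp: H_def)
  qed
  moreover have "(x, y) \<notin> E \<and> x \<noteq> y" if "H x y" for x y
  proof -
    have "(p, q) \<notin> E \<and> p \<noteq> q" if "p \<in> W" "q \<in> B p" for p q
      using B[OF that(1)] that(2) by (auto simp: N_def)
    then show ?thesis using \<open>H x y\<close> E(2) unfolding H_def by (blast dest: symD)
  qed
  ultimately show ?thesis using B
    by (intro exI[of _ H]) (auto simp: H_def)
qed

section \<open>Degree sums of the marked graph\<close>

locale star_count = edge_count +
  fixes W :: "'a set" and r :: nat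
  assumes WV: "W \<subseteq> V" and HW: "H x y \<Longrightarrow> x \<in> W \<or> y \<in> W"
    and HD: "x \<in> W \<Longrightarrow> card {y\<in>V. H x y} = r"
begin

abbreviation "w \<equiv> card W"

text \<open>Ordered pairs make this twice the number of marked edges inside \<open>W\<close>, so
  that \<open>w * r - T\<close> marked edges leave \<open>W\<close>.\<close>

definition T :: nat where "T = card ({(x, y). H x y} \<inter> W \<times> W)"

lemma finW: "finite W" using WV finV by (rule finite_subset)

lemma D_card: "D x = real (card {y\<in>V. H x y})"
  using finV by (simp add: D_def h_def of_bool_def flip: sum.inter_filter)

lemma D_W: "x \<in> W \<Longrightarrow> D x = r"
  by (simp add: D_card HD)

lemma T_sum: "real T = (\<Sum>x\<in>W. \<Sum>y\<in>W. h x y)"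
proof -
  have "(\<Sum>x\<in>W. \<Sum>y\<in>W. h x y) = (\<Sum>p\<in>W \<times> W. if H (fst p) (snd p) then 1 else 0)"
    by (simp add: sum.cartesian_product h_def of_bool_def case_prod_unfold)
  also have "\<dots> = real (card {p \<in> W \<times> W. H (fst p) (snd p)})"
    using finW by (simp flip: sum.inter_filter)
  also have "{p \<in> W \<times> W. H (fst p) (snd p)} = {(x, y). H x y} \<inter> W \<times> W" by auto
  finally show ?thesis by (simp add: T_def)
qed

lemma even_T: "even T"
  unfolding T_def using finW Hsym Hirr by (intro even_card_sym_irrefl) (auto simp: sym_def irrefl_def)

lemma T_le: "T \<le> w * (w - 1)"
proof -
  have "{(x, y). H x y} \<inter> W \<times> W \<subseteq> W \<times> W - (\<lambda>x. (x, x)) ` W"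
    using Hirr by auto
  then have "T \<le> card (W \<times> W - (\<lambda>x. (x, x)) ` W)"
    unfolding T_def using finW by (intro card_mono) auto
  also have "\<dots> = card (W \<times> W) - card ((\<lambda>x. (x, x)) ` W)"
    using finW by (intro card_Diff_subset) auto
  also have "card ((\<lambda>x. (x, x)) ` W) = w" by (intro card_image) (auto simp: inj_on_def)
  finally show ?thesis by (simp add: card_cartesian_product diff_mult_distrib2)
qed

lemma sum_out: "(\<Sum>x\<in>V - W. D x) = real w * r - T"
proof -
  have "(\<Sum>x\<in>V - W. D x) = (\<Sum>x\<in>V - W. \<Sum>y\<in>W. h x y)"
  proof (rule sum.cong[OF refl])
    fix x assume x: "x \<in> V - W"
    have "D x = (\<Sum>y\<in>W. h x y)"
      unfolding D_def using HW x WV finV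
      by (intro sum.mono_neutral_right) (auto simp: h_def)
    then show "D x = (\<Sum>y\<in>W. h x y)" .
  qed
  also have "\<dots> = (\<Sum>y\<in>W. \<Sum>x\<in>V - W. h y x)"
    by (subst sum.swap) (simp add: h_sym)
  also have "\<dots> = (\<Sum>y\<in>W. D y - (\<Sum>x\<in>W. h y x))"
    using finV WV by (intro sum.cong[OF refl]) (simp add: D_def sum_diff)
  also have "\<dots> = (\<Sum>y\<in>W. D y) - T"
    by (simp add: sum_subtractf T_sum)
  finally show ?thesis by (simp add: D_W)
qed

lemma out_nonneg: "0 \<le> real w * r - T"
  unfolding sum_out[symmetric] by (intro sum_nonneg) (simp add: D_card)

lemma S_eq: "S = real w * r + (real w * r - T)"
proof -
  have "S = (\<Sum>x\<in>V - W. D x) + (\<Sum>x\<in>W. D x)"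
    unfolding S_def using finV WV by (rule sum.subset_diff[rotated])
  then show ?thesis by (simp add: sum_out D_W)
qed

lemma Q_eq: "Q = real w * (real r)\<^sup>2 + (\<Sum>x\<in>V - W. (D x)\<^sup>2)"
proof -
  have "Q = (\<Sum>x\<in>V - W. (D x)\<^sup>2) + (\<Sum>x\<in>W. (D x)\<^sup>2)"
    unfolding Q_def using finV WV by (rule sum.subset_diff[rotated])
  then show ?thesis by (simp add: D_W)
qed

lemma card_out: "card (V - W) = n - w"
  using WV finW by (rule card_Diff_subset[rotated])

text \<open>The degrees outside \<open>W\<close> have nonnegative variance; \<open>m\<close> is
  their mean.\<close>

lemma Q_ge:
  assumes "w < n"
  shows "real w * (real r)\<^sup>2 + (real w * r - T)\<^sup>2 / (real n - w) \<le> Q"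
proof -
  define m where "m = (real w * r - T) / (real n - w)"
  have "0 \<le> (\<Sum>x\<in>V - W. (D x - m)\<^sup>2)" by (intro sum_nonneg) simp
  also have "\<dots> = (\<Sum>x\<in>V - W. (D x)\<^sup>2) - 2 * m * (\<Sum>x\<in>V - W. D x) + (real n - w) * m\<^sup>2"
    using assms by (simp add: power2_diff sum.distrib sum_subtractf card_out mult.commute flip: sum_distrib_left)
  also have "(real n - w) * m\<^sup>2 = m * (real w * r - T)"
    using assms by (simp add: m_def power2_eq_square)
  also have "2 * m * (\<Sum>x\<in>V - W. D x) = 2 * (m * (real w * r - T))"
    by (simp add: sum_out)
  also have "m * (real w * r - T) = (real w * r - T)\<^sup>2 / (real n - w)"
    by (simp add: m_def power2_eq_square)
  finally show ?thesis by (simp add: Q_eq)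
qed

text \<open>The integrality of the degrees outside \<open>W\<close> improves \<open>Q_ge\<close> when they are small.\<close>

lemma Q_cases:
  "real w * (real r)\<^sup>2 + (real w * r - T) + 2 \<le> Q \<or>
   real w * (real r)\<^sup>2 + (real w * r - T) \<le> Q \<and> (\<forall>x\<in>V - W. card {y\<in>V. H x y} \<le> 1)"
proof -
  let ?d = "\<lambda>x. card {y\<in>V. H x y}"
  have sq: "D x \<le> (D x)\<^sup>2" for x
    by (cases "?d x") (auto simp: D_card power2_eq_square)
  show ?thesis
  proof (cases "\<forall>x\<in>V - W. ?d x \<le> 1")
    case True
    then show ?thesis using sum_mono[of "V - W" D "\<lambda>x. (D x)\<^sup>2"] sq by (simp add: Q_eq sum_out)
  next
    case False
    then obtain x where x: "x \<in> V - W" "2 \<le> ?d x" by force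
    have "2 \<le> D x" using x by (simp add: D_card)
    then have "0 \<le> (D x - 2) * (D x + 1)" by simp
    then have "D x + 2 \<le> (D x)\<^sup>2" by (simp add: power2_eq_square algebra_simps)
    moreover have "(\<Sum>y\<in>V - W - {x}. D y) \<le> (\<Sum>y\<in>V - W - {x}. (D y)\<^sup>2)"
      using sq by (intro sum_mono)
    moreover have "(\<Sum>y\<in>V - W. D y) = D x + (\<Sum>y\<in>V - W - {x}. D y)"
      "(\<Sum>y\<in>V - W. (D y)\<^sup>2) = (D x)\<^sup>2 + (\<Sum>y\<in>V - W - {x}. (D y)\<^sup>2)"
      using x finV by (auto intro!: sum.remove)
    ultimately show ?thesis by (simp add: Q_eq sum_out)
  qed
qed

section \<open>The three small configurations\<close>

lemma neighbour_unique:
  assumes "card {y\<in>V. H x y} \<le> 1" "H x a" "H x b" "a \<in> V" "b \<in> V"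
  shows "a = b"
  using assms finV by (auto simp: card_le_Suc0_iff_eq)

text \<open>The right side is \<open>(m - 2)(m - 3)/2\<close>, with values \<open>3\<close>,
  \<open>1\<close>, \<open>0\<close>, \<open>0\<close> at the first integers. The excess
  \<open>2\<close> at \<open>m = 0\<close> is kept because it can make a non-strict bound
  strict.\<close>

lemma quadratic_23: "of_bool (m \<le> 1) + 2 * of_bool (m = 0) \<le> 3 + (- 5 / 2) * real m + (1 / 2) * (real m)\<^sup>2"
proof -
  consider "m = 0" | "m = 1" | "m = 2" | "3 \<le> m" by linarith
  then show ?thesis
  proof cases
    case 4
    then have "0 \<le> (real m - 2) * (real m - 3)" by simp
    then show ?thesis using 4 by (simp add: power2_eq_square algebra_simps)
  qed (auto simp: power2_eq_square)
qed

lemma card_low_less_23: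
  assumes n: "4 \<le> n"
    and le: "3 * (real n - 1) * (real n - 2) - 2 * (real n - 2) * S + (S\<^sup>2 / 2 - Q) \<le> 2 * (real n - 2)"
    and less: "3 * (real n - 1) * (real n - 2) - 2 * (real n - 2) * S + (S\<^sup>2 / 2 - Q) < 2 * (real n - 2)
       \<or> (\<exists>xs\<in>permutations_of_set V. X xs = 0)"
  shows "real (card low) < 2 * real n * fact (n - 2)"
proof -
  let ?z = "\<Sum>xs\<in>permutations_of_set V. 2 * of_bool (X xs = 0) :: real"
  let ?c = "3 * (real n - 1) * (real n - 2) - 2 * (real n - 2) * S + (S\<^sup>2 / 2 - Q)"
  have c: "real (card low) + ?z \<le> real n * fact (n - 3) * ?c"
    using card_low_le[of "\<lambda>xs. 2 * of_bool (X xs = 0)", OF n quadratic_23] by (simp add: algebra_simps)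
  have z: "0 \<le> ?z" by (intro sum_nonneg) auto
  have eq: "2 * real n * fact (n - 2) = real n * fact (n - 3) * (2 * (real n - 2))"
    unfolding fact_n(2)[OF n] by simp
  from less show ?thesis
  proof
    assume "?c < 2 * (real n - 2)"
    then have "real n * fact (n - 3) * ?c < real n * fact (n - 3) * (2 * (real n - 2))"
      using n by (intro mult_strict_left_mono) auto
    then show ?thesis using c z eq by linarith
  next
    assume "\<exists>xs\<in>permutations_of_set V. X xs = 0"
    then obtain xs where xs: "xs \<in> permutations_of_set V" "X xs = 0" by blast
    have "2 * of_bool (X xs = 0) \<le> ?z"
      using xs finV by (intro member_le_sum) auto
    then have "2 \<le> ?z" using xs by simp
    moreover have "real n * fact (n - 3) * ?c \<le> real n * fact (n - 3) * (2 * (real n - 2))"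
      using le by (intro mult_left_mono) auto
    ultimately show ?thesis using c eq by linarith
  qed
qed

lemma X_eq_0: "(\<And>i. i < n \<Longrightarrow> \<not> H (xs ! i) (xs ! sc i)) \<Longrightarrow> X xs = 0"
  by (simp add: X_def)

text \<open>
  In the next two configurations the polynomial \<open>(X - 2)(X - 3)/2\<close> may give exactly the non-strict bound;
  strictness then comes from an explicit arrangement with \<open>X = 0\<close>.
\<close>

lemma card_low_less_order_6:
  assumes "n = 6" "w = 2" "r = 3" "T = 2"
  shows "real (card low) < 2 * real n * fact (n - 2)"
proof (rule card_low_less_23)
  have S: "S = 10" using S_eq assms by simp
  \<comment> \<open>The goal compares \<open>30 - Q\<close> with \<open>8\<close>, so
    \<open>Q = 22\<close> is the tight value.\<close>
  have "22 \<le> Q" using Q_cases assms by auto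
  then show "3 * (real n - 1) * (real n - 2) - 2 * (real n - 2) * S + (S\<^sup>2 / 2 - Q) \<le> 2 * (real n - 2)"
    using assms S by simp
  consider "24 \<le> Q" | "\<And>x. x \<in> V - W \<Longrightarrow> card {y\<in>V. H x y} \<le> 1"
    using Q_cases assms by auto
  then show "3 * (real n - 1) * (real n - 2) - 2 * (real n - 2) * S + (S\<^sup>2 / 2 - Q) < 2 * (real n - 2)
       \<or> (\<exists>xs\<in>permutations_of_set V. X xs = 0)"
  proof cases
    case 1
    then show ?thesis using assms S by simp
  next
    case 2
    obtain a b where ab: "W = {a, b}" "a \<noteq> b" using assms(2) by (auto simp: card_2_iff)
    have "H a b"
    proof (rule ccontr)
      assume "\<not> H a b"
      then have "{(x, y). H x y} \<inter> W \<times> W = {}" using ab Hirr Hsym by auto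
      then show False using assms by (simp add: T_def)
    qed
    define A where "A = {y \<in> V. H a y} - {b}"
    define B where "B = {y \<in> V. H b y} - {a}"
    have "card A = 2" "card B = 2"
      using HD[of a] HD[of b] ab \<open>H a b\<close> Hsym[OF \<open>H a b\<close>] WV finV assms by (auto simp: A_def B_def)
    then obtain x y z u where xy: "A = {x, y}" "x \<noteq> y" and zu: "B = {z, u}" "z \<noteq> u"
      by (auto simp: card_2_iff)
    have out: "x \<in> V - W" "y \<in> V - W" "z \<in> V - W" "u \<in> V - W"
    proof -
      have "A \<subseteq> V - W" "B \<subseteq> V - W" using ab(1) Hirr by (auto simp: A_def B_def)
      then show "x \<in> V - W" "y \<in> V - W" "z \<in> V - W" "u \<in> V - W"
        using xy(1) zu(1) by blast+
    qed
    have Hab: "H a x" "H a y" "H b z" "H b u"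
      using xy(1) zu(1) unfolding A_def B_def by blast+
    have nb: "\<not> H b x" "\<not> H b y" "\<not> H a z" "\<not> H a u"
      using neighbour_unique[OF 2, of _ a b] out Hab Hsym ab WV by (metis insert_subset)+
    have nout: "\<not> H p q" if "p \<in> V - W" "q \<in> V - W" for p q using HW that by blast
    \<comment> \<open>Each of \<open>a\<close>, \<open>b\<close> is put between the two outside
      vertices marked with the other one; the remaining adjacent pairs lie outside
      \<open>W\<close>.\<close>
    have ds: "distinct [z, a, u, x, b, y]"
      using ab xy zu out Hab nb by auto
    moreover have "set [z, a, u, x, b, y] = V"
      using ab out WV finV assms(1) distinct_card[OF ds] by (intro card_subset_eq) auto
    ultimately have "[z, a, u, x, b, y] \<in> permutations_of_set V"
      by (simp add: permutations_of_set_def)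
    moreover have "X [z, a, u, x, b, y] = 0"
    proof (rule X_eq_0)
      fix i assume "i < n"
      then consider "i = 0" | "i = 1" | "i = 2" | "i = 3" | "i = 4" | "i = 5"
        using assms(1) by linarith
      then show "\<not> H ([z, a, u, x, b, y] ! i) ([z, a, u, x, b, y] ! sc i)"
        using nb nout[OF out(4,1)] nout[OF out(2,3)] Hsym assms(1) by cases (auto simp: sc_def)
    qed
    ultimately show ?thesis by blast
  qed
qed (use assms in auto)

lemma card_low_less_order_7:
  assumes "n = 7" "w = 4" "r = 3" "T = 10"
  shows "real (card low) < 2 * real n * fact (n - 2)"
proof (rule card_low_less_23)
  have S: "S = 14" using S_eq assms by simp
  \<comment> \<open>Here \<open>48 - Q\<close> is compared with \<open>10\<close>, with equality at
    \<open>Q = 38\<close>.\<close>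
  have "38 \<le> Q" using Q_cases assms by auto
  then show "3 * (real n - 1) * (real n - 2) - 2 * (real n - 2) * S + (S\<^sup>2 / 2 - Q) \<le> 2 * (real n - 2)"
    using assms S by simp
  consider "40 \<le> Q" | "\<And>x. x \<in> V - W \<Longrightarrow> card {y\<in>V. H x y} \<le> 1"
    using Q_cases assms by auto
  then show "3 * (real n - 1) * (real n - 2) - 2 * (real n - 2) * S + (S\<^sup>2 / 2 - Q) < 2 * (real n - 2)
       \<or> (\<exists>xs\<in>permutations_of_set V. X xs = 0)"
  proof cases
    case 1
    then show ?thesis using assms S by simp
  next
    case 2
    \<comment> \<open>The unmarked ordered pairs inside \<open>W\<close>: two of the twelve, hence
      one unordered pair \<open>a\<close>, \<open>b\<close>.\<close>
    define M where "M = W \<times> W - (\<lambda>x. (x, x)) ` W - {(x, y). H x y}"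
    have M: "M = W \<times> W - ((\<lambda>x. (x, x)) ` W \<union> ({(x, y). H x y} \<inter> W \<times> W))" by (auto simp: M_def)
    have "card ((\<lambda>x. (x, x)) ` W \<union> ({(x, y). H x y} \<inter> W \<times> W)) = 4 + 10"
    proof -
      have "card ((\<lambda>x. (x, x)) ` W) = 4" using assms by (subst card_image) (auto simp: inj_on_def)
      then show ?thesis using assms finW Hirr by (subst card_Un_disjoint) (auto simp: T_def)
    qed
    then have "card M = 2"
      using finW assms by (subst M, subst card_Diff_subset) (auto simp: card_cartesian_product)
    then have "M \<noteq> {}" by auto
    then obtain a b where ab: "(a, b) \<in> M" by auto
    have abW: "a \<in> W" "b \<in> W" "a \<noteq> b" "\<not> H a b" using ab by (auto simp: M_def)
    have M2: "M = {(a, b), (b, a)}"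
      using abW Hsym \<open>card M = 2\<close> finW by (intro card_subset_eq[symmetric]) (auto simp: M_def)
    have full: "H p q" if "p \<in> W" "q \<in> W" "p \<noteq> q" "{p, q} \<noteq> {a, b}" for p q
    proof (rule ccontr)
      assume "\<not> H p q"
      then have "(p, q) \<in> M" using that by (auto simp: M_def)
      then show False using that(4) M2 by auto
    qed
    have "card (W - {a, b}) = 2" using abW finW assms by (simp add: card_Diff_subset)
    then obtain c d where cd: "W - {a, b} = {c, d}" "c \<noteq> d" by (auto simp: card_2_iff)
    then have W: "W = {a, b, c, d}" and dW: "distinct [a, b, c, d]" using abW by auto
    have Hs: "H a c" "H a d" "H b c" "H b d" "H c a" "H c b" "H c d" "H d a" "H d b" "H d c"
      using W dW by (auto intro!: full)
    have inV: "a \<in> V" "b \<in> V" "c \<in> V" "d \<in> V" using W WV by auto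
    have "card ({y \<in> V. H a y} - {c, d}) = 1" "card ({y \<in> V. H b y} - {c, d}) = 1"
      using HD[of a] HD[of b] W dW Hs inV finV assms by (auto simp: card_Diff_subset)
    then obtain x y where x: "{y \<in> V. H a y} - {c, d} = {x}" and y: "{z \<in> V. H b z} - {c, d} = {y}"
      by (metis card_1_singletonE)
    have Hxy: "H a x" "H b y" and xy: "x \<in> V" "y \<in> V" "x \<noteq> c" "x \<noteq> d" "y \<noteq> c" "y \<noteq> d"
      using x y by blast+
    have "x \<noteq> a" "x \<noteq> b" "y \<noteq> a" "y \<noteq> b"
      using Hxy abW(4) Hirr Hsym by metis+
    then have out: "x \<in> V - W" "y \<in> V - W" using xy W by auto
    have "\<not> H b x" "\<not> H a y"
      using neighbour_unique[OF 2[OF out(1)] Hsym[OF Hxy(1)] _ inV(1,2)]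
        neighbour_unique[OF 2[OF out(2)] _ Hsym[OF Hxy(2)] inV(1,2)] Hsym abW(3) by metis+
    have cN: "{z \<in> V. H c z} = {a, b, d}"
      using HD[of c] W dW Hs inV finV assms by (intro card_subset_eq[symmetric]) auto
    have dN: "{z \<in> V. H d z} = {a, b, c}"
      using HD[of d] W dW Hs inV finV assms by (intro card_subset_eq[symmetric]) auto
    have "x \<noteq> y" using Hxy \<open>\<not> H b x\<close> by auto
    have "card (V - {a, b, c, d, x, y}) = 1"
      using inV out W dW \<open>x \<noteq> y\<close> finV assms by (subst card_Diff_subset) auto
    then obtain z where z: "V - {a, b, c, d, x, y} = {z}" by (metis card_1_singletonE)
    have zV: "z \<in> V" "z \<notin> {a, b, c, d, x, y}" using z by auto
    have "\<not> H a z" using x zV by auto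
    have cx: "\<not> H c x" "\<not> H c y" "\<not> H d y" "\<not> H d z"
      using cN dN out W zV by auto
    \<comment> \<open>All three marks of \<open>c\<close> and of \<open>d\<close> lie inside
      \<open>W\<close>, so these two fit between outside vertices; \<open>a\<close> and
      \<open>b\<close> stand together, flanked by \<open>z\<close> and \<open>x\<close>, which are
      not marked with them.\<close>
    have ds: "distinct [a, b, x, c, y, d, z]"
      using dW out W \<open>x \<noteq> y\<close> zV by auto
    moreover have "set [a, b, x, c, y, d, z] = V"
      using inV out zV finV assms(1) distinct_card[OF ds] by (intro card_subset_eq) auto
    ultimately have "[a, b, x, c, y, d, z] \<in> permutations_of_set V"
      by (simp add: permutations_of_set_def)
    moreover have "X [a, b, x, c, y, d, z] = 0"
    proof (rule X_eq_0)
      fix i assume "i < n"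
      then consider "i = 0" | "i = 1" | "i = 2" | "i = 3" | "i = 4" | "i = 5" | "i = 6"
        using assms(1) by linarith
      then show "\<not> H ([a, b, x, c, y, d, z] ! i) ([a, b, x, c, y, d, z] ! sc i)"
        using abW(4) \<open>\<not> H b x\<close> cx \<open>\<not> H a z\<close> Hsym assms(1) by cases (auto simp: sc_def)
    qed
    ultimately show ?thesis by blast
  qed
qed (use assms in auto)

text \<open>The polynomial \<open>(X - 3)(X - 4)/6\<close> compares \<open>30 - Q / 3\<close> with
  \<open>12\<close>, which needs only \<open>Q > 54\<close>. The polynomial of
  \<open>quadratic_23\<close> would need \<open>Q \<ge> 60\<close>, beyond what \<open>Q_ge\<close>
  provides.\<close>

lemma card_low_less_order_8:
  assumes "n = 8" "w = 3" "r = 4" "T = 6"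
  shows "real (card low) < 2 * real n * fact (n - 2)"
proof -
  have S: "S = 18" using S_eq assms by simp
  have Q: "48 + 36 / 5 \<le> Q" using Q_ge assms by simp
  have g: "of_bool (m \<le> 1) + (0 :: real) \<le> 2 + (- 7 / 6) * real m + (1 / 6) * (real m)\<^sup>2" for m :: nat
  proof -
    consider "m = 0" | "m = 1" | "m = 2" | "m = 3" | "4 \<le> m" by linarith
    then show ?thesis
    proof cases
      case 5
      then have "0 \<le> (real m - 3) * (real m - 4)" by simp
      then show ?thesis using 5 by (simp add: power2_eq_square algebra_simps)
    qed (auto simp: power2_eq_square)
  qed
  have "real (card low) \<le> 8 * fact 5 * (54 - Q / 3 - 24)"
    using card_low_le[of "\<lambda>_. 0", OF _ g] assms S by (simp add: algebra_simps)
  also have "\<dots> < 2 * 8 * fact 6"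
    using Q by (simp add: fact_numeral)
  finally show ?thesis using assms by simp
qed

text \<open>The alternatives in \<open>sizes\<close> are those of \<open>posa\<close>,
  \<open>w = k\<close> and \<open>w = k + 1\<close>, with \<open>r = n - 1 - k\<close> in
  both.\<close>

lemma card_low_less_star:
  assumes n: "6 \<le> n"
    and sizes: "2 \<le> w \<and> 2 * w + 2 \<le> n \<and> r + w + 1 = n \<or> n + 1 = 2 * w \<and> r + 1 = w"
  shows "real (card low) < 2 * real n * fact (n - 2)"
proof -
  define s where "s = real w * r - T"
  have s: "0 \<le> s" "s \<le> real w * r" using out_nonneg by (auto simp: s_def)
  have wn: "w < n" using sizes n by auto
  have S: "S = real w * r + s" using S_eq by (simp add: s_def)
  have Q: "real w * (real r)\<^sup>2 + s\<^sup>2 / (real n - w) \<le> Q" using Q_ge[OF wn] by (simp add: s_def)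
  \<comment> \<open>This makes the mean \<open>S / (n - 1)\<close> of \<open>X\<close> at least
    \<open>1\<close>, as \<open>card_low_less\<close> requires.\<close>
  have "n - 1 \<le> w * r"
  proof (cases "n + 1 = 2 * w")
    case True
    then have "n = 2 * r + 1" "w = r + 1" "2 \<le> r" using sizes n by auto
    then show ?thesis by simp
  next
    case False
    then have c: "2 \<le> w" "2 * w + 2 \<le> n" "r + w + 1 = n" using sizes by auto
    obtain v where v: "w = 2 + v" using le_Suc_ex[OF c(1)] by blast
    obtain t where "n = 2 * w + 2 + t" using le_Suc_ex[OF c(2)] by blast
    then have "r = v + 3 + t" "n = 2 * v + 6 + t" using c v by auto
    then show ?thesis using v by (simp add: algebra_simps)
  qed
  then have Sn: "real n - 1 \<le> S" using s S n by (simp add: of_nat_diff flip: of_nat_mult)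
  have fin: ?thesis if "criterion n S Q"
    using card_low_less[OF _ Sn] that n by (simp add: criterion_def)
  show ?thesis
  proof (cases "n + 1 = 2 * w")
    case True
    then have r: "r + 1 = w" using sizes by auto
    show ?thesis
    proof (cases "5 \<le> w")
      case True
      have "criterion n (real w * r + s) Q"
        using True r \<open>n + 1 = 2 * w\<close> Q by (intro criterion_odd) auto
      then show ?thesis using fin S by simp
    next
      case False
      then have "w = 4" using \<open>n + 1 = 2 * w\<close> n by linarith
      then have w4: "w = 4" "n = 7" "r = 3" using \<open>n + 1 = 2 * w\<close> r by auto
      show ?thesis
      proof (cases "T = 10")
        case True
        then show ?thesis using card_low_less_order_7 w4 by simp
      next
        case False
        \<comment> \<open>With \<open>s = 12 - T\<close> the quadratic is
          \<open>11 s^2 - 48 s + 36\<close>; among even \<open>s \<ge> 0\<close> it is negative only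
          at \<open>s = 2\<close>, that is, at \<open>T = 10\<close>.\<close>
        have "T \<le> 12" using T_le w4 by simp
        then have "T \<in> {0, 2, 4, 6, 8, 12}" using even_T False by (auto elim!: evenE)
        then have "criterion 7 (4 * 3 + s) Q"
          using Q w4 by (intro criterionI[of 4]) (auto simp: s_def power2_eq_square)
        then show ?thesis using fin S w4 by simp
      qed
    qed
  next
    case False
    then have c: "2 \<le> w" "2 * w + 2 \<le> n" "r + w + 1 = n" using sizes by auto
    define p where "p = real n - 2 * real w - 2"
    have p: "0 \<le> p" "real n = 2 * real w + 2 + p" "real r = real w + 1 + p"
      using c by (auto simp: p_def)
    consider "4 \<le> w" | "w = 2" | "w = 3" using c by linarith
    then show ?thesis
    proof cases
      case 1
      then have "criterion n (real w * r + s) Q"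
        using p s Q by (intro criterion_even) auto
      then show ?thesis using fin S by simp
    next
      case 2
      then have "T \<le> 2" using T_le by simp
      then consider "T = 0" | "T = 2" "n = 6" | "T = 2" "7 \<le> n" using even_T n by (cases "T = 1") (auto, linarith)
      then show ?thesis
      proof cases
        case 2
        then show ?thesis using card_low_less_order_6 \<open>w = 2\<close> c by simp
      next
        case 1
        then show ?thesis
          using criterion_two[of p n r T Q] p Q \<open>w = 2\<close> fin S by (simp add: s_def)
      next
        case 3
        then show ?thesis
          using criterion_two[of p n r T Q] p Q \<open>w = 2\<close> fin S by (simp add: s_def)
      qed
    next
      case 3
      then have "T \<le> 6" using T_le by simp
      then have T: "T = 0 \<or> T = 2 \<or> T = 4 \<or> T = 6" using even_T by (auto elim!: evenE)
      show ?thesis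
      proof (cases "T = 6 \<and> n = 8")
        case True
        then show ?thesis using card_low_less_order_8 3 c by simp
      next
        case False
        then have "T = 6 \<longrightarrow> 1 \<le> p" using c 3 by (auto simp: p_def)
        then show ?thesis
          using T criterion_three[of p n r T Q] p Q 3 fin S by (auto simp: s_def)
      qed
    qed
  qed
qed

end

lemma ham_lists_less:
  assumes V: "finite V" "6 \<le> card V" and E: "E \<subseteq> V \<times> V" "sym E" "irrefl E" and nh: "no_ham_cycle V E"
    and deg: "\<And>u. u \<in> V \<Longrightarrow> 2 \<le> deg E u"
  shows "card (ham_lists V E) < 2 * fact (card V - 2)"
proof -
  have 1: "\<not> (\<exists>u\<in>V. deg E u \<le> 1)" using deg by force
  have 3: "3 \<le> card V" using V(2) by simp
  obtain k W where k: "2 \<le> k" and W: "W \<subseteq> V" "\<And>x. x \<in> W \<Longrightarrow> deg E x \<le> k"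
    and kW: "2 * k + 2 \<le> card V \<and> card W = k \<or> card V = 2 * k + 1 \<and> card W = k + 1"
    using posa[OF V(1) 3 E nh] 1 by blast
  \<comment> \<open>The number of non-neighbours guaranteed at a vertex of degree at most
    \<open>k\<close>.\<close>
  define r where "r = card V - 1 - k"
  have r: "r + k + 1 = card V" using kW by (auto simp: r_def)
  have "deg E x + r + 1 \<le> card V" if "x \<in> W" for x using W(2)[OF that] r by simp
  moreover have "card W \<le> r + 1" using kW r by auto
  ultimately obtain H where H: "\<forall>x y. H x y \<longrightarrow> H y x" "\<forall>x. \<not> H x x" "\<forall>x y. H x y \<longrightarrow> (x, y) \<notin> E"
    "\<forall>x y. H x y \<longrightarrow> x \<in> W \<or> y \<in> W" "\<forall>x\<in>W. card {y\<in>V. H x y} = r"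
    using exists_nonedges[OF V(1) W(1) E, of r] by blast
  interpret star_count V H W r
    using V(1) W(1) H by unfold_locales auto
  show ?thesis
  proof (rule card_ham_lists_less[OF nh])
    show "real (card low) < 2 * real (card V) * fact (card V - 2)"
      using kW k r V(2) by (intro card_low_less_star) auto
  qed (use H in auto)
qed

section \<open>Pendant vertices and the extremal graph\<close>

lemma pair_pre_digraph_eq_iff:
  "P = \<lparr>pverts = A, parcs = B\<rparr> \<longleftrightarrow> pverts P = A \<and> parcs P = B" for P :: "'a pair_pre_digraph"
  by (cases P) auto

definition path_of :: "'a list \<Rightarrow> 'a pair_pre_digraph" where
  "path_of xs = \<lparr> pverts = set xs, parcs = set (vwalk_arcs xs) \<union> (set (vwalk_arcs xs))\<inverse> \<rparr>"

lemma vwalk_arcs_in_set: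
  "(x, y) \<in> set (vwalk_arcs xs) \<Longrightarrow> x \<in> set xs \<and> y \<in> set xs"
  by (induction xs rule: vwalk_arcs.induct) auto

lemma vwalk_arcs_rev: "set (vwalk_arcs (rev xs)) = (set (vwalk_arcs xs))\<inverse>"
proof (induction xs rule: vwalk_arcs.induct)
  case (3 x y zs)
  have "set (vwalk_arcs (rev (x # y # zs))) = insert (y, x) (set (vwalk_arcs (rev (y # zs))))"
    using set_vwalk_arcs_snoc[of "rev (y # zs)" x] by (simp add: last_rev)
  then show ?case using 3 by auto
qed auto

lemma path_of_rev: "path_of (rev xs) = path_of xs"
  by (auto simp: path_of_def vwalk_arcs_rev)

text \<open>Fixing the first vertex rules out the reversed list. That vertex has one neighbour on
  the path, which must be the second entry; deleting its arcs leaves a shorter path with known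
  start.\<close>

lemma path_of_inj:
  assumes "distinct xs" "distinct ys" "xs \<noteq> []" "ys \<noteq> []" "hd xs = hd ys" "path_of xs = path_of ys"
  shows "xs = ys"
  using assms
proof (induction xs arbitrary: ys)
  case (Cons x xs')
  obtain ys' where ys: "ys = x # ys'" using Cons.prems by (cases ys) auto
  have sets: "set xs' = set ys'"
    using Cons.prems ys by (auto simp: path_of_def)
  show ?case
  proof (cases "xs' = []")
    case True
    then show ?thesis using sets ys by auto
  next
    case False
    then have ne: "xs' \<noteq> []" "ys' \<noteq> []" using sets by auto
    have arcs: "parcs (path_of (x # zs)) = {(x, hd zs), (hd zs, x)} \<union> parcs (path_of zs)" if "zs \<noteq> []" for zs
      using that by (auto simp: path_of_def)
    have nox: "(x, y) \<notin> parcs (path_of zs)" "(y, x) \<notin> parcs (path_of zs)" if "x \<notin> set zs" for y zs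
      using that vwalk_arcs_in_set[of _ _ zs] by (auto simp: path_of_def)
    have x: "x \<notin> set xs'" "x \<notin> set ys'" using Cons.prems ys by auto
    have eq: "{(x, hd xs'), (hd xs', x)} \<union> parcs (path_of xs') = {(x, hd ys'), (hd ys', x)} \<union> parcs (path_of ys')"
      using Cons.prems(6) arcs[OF ne(1)] arcs[OF ne(2)] ys by simp
    have "(x, hd xs') \<in> {(x, hd ys'), (hd ys', x)} \<union> parcs (path_of ys')"
      unfolding eq[symmetric] by simp
    then have hd: "hd xs' = hd ys'" using nox x by auto
    have "parcs (path_of xs') = parcs (path_of ys')"
    proof (rule set_eqI)
      fix e
      show "e \<in> parcs (path_of xs') \<longleftrightarrow> e \<in> parcs (path_of ys')"
      proof (cases "e \<in> {(x, hd ys'), (hd ys', x)}")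
        case True
        then show ?thesis using nox[OF x(1)] nox[OF x(2)] by auto
      next
        case False
        then show ?thesis using arg_cong[OF eq, of "\<lambda>A. e \<in> A"] unfolding hd by simp
      qed
    qed
    then have "path_of xs' = path_of ys'" using sets by (simp add: path_of_def)
    then have "xs' = ys'" using Cons.IH[of ys'] Cons.prems ys ne hd by simp
    then show ?thesis using ys by simp
  qed
qed simp

lemma pair_graphD:
  assumes "pair_graph G"
  shows "finite (pverts G)" "parcs G \<subseteq> pverts G \<times> pverts G" "sym (parcs G)" "irrefl (parcs G)"
proof -
  interpret pair_graph G by fact
  show "finite (pverts G)" by (rule pair_finite_verts)
  show "parcs G \<subseteq> pverts G \<times> pverts G" using in_arcsD1 in_arcsD2 by auto
  show "sym (parcs G)" using pair_sym_arcs by (simp add: symmetric_def)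
  show "irrefl (parcs G)" using pair_no_loops by (metis irreflI fst_conv snd_conv)
qed

lemma spanning_iff:
  assumes G: "pair_graph G" and P: "parcs P \<subseteq> pverts P \<times> pverts P"
  shows "spanning (with_proj P) (with_proj G) \<longleftrightarrow> pverts P = pverts G \<and> parcs P \<subseteq> parcs G"
proof -
  have "wf_digraph (with_proj P)" using P by unfold_locales auto
  moreover have "wf_digraph (with_proj G)" using pair_graphD(2)[OF G] by unfold_locales auto
  ultimately show ?thesis
    by (auto simp: spanning_def subgraph_def compatible_def)
qed

lemma hamilton_paths_eq:
  assumes G: "pair_graph G" and ne: "pverts G \<noteq> {}"
  shows "hamilton_paths G = path_of ` ham_lists (pverts G) (parcs G)"
proof -
  have sub: "parcs (path_of xs) \<subseteq> pverts (path_of xs) \<times> pverts (path_of xs)" for xs :: "'a list"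
    using vwalk_arcs_in_set[of _ _ xs] by (auto simp: path_of_def)
  have "P = path_of xs \<longleftrightarrow> pverts P = set xs \<and> parcs P = set (vwalk_arcs xs) \<union> (set (vwalk_arcs xs))\<inverse>"
    for P and xs :: "'a list"
    unfolding path_of_def by (rule pair_pre_digraph_eq_iff)
  then have "P \<in> hamilton_paths G \<longleftrightarrow> (\<exists>xs. xs \<noteq> [] \<and> distinct xs \<and> P = path_of xs \<and>
      spanning (with_proj (path_of xs)) (with_proj G))" for P
    unfolding hamilton_paths_def path_graph_def mem_Collect_eq by metis
  moreover have "spanning (with_proj (path_of xs)) (with_proj G) \<longleftrightarrow>
      set xs = pverts G \<and> set (vwalk_arcs xs) \<subseteq> parcs G" for xs
    unfolding spanning_iff[OF G sub] using pair_graphD(3)[OF G] by (auto simp: path_of_def dest: symD)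
  moreover have "xs \<in> ham_lists (pverts G) (parcs G) \<longleftrightarrow>
      xs \<noteq> [] \<and> distinct xs \<and> set xs = pverts G \<and> set (vwalk_arcs xs) \<subseteq> parcs G" for xs
    using ne by (auto simp: ham_lists_def permutations_of_set_def)
  ultimately show ?thesis
    by (intro set_eqI) (metis (no_types, lifting) image_iff)
qed

lemma hamiltonian_iff:
  assumes G: "pair_graph G" and n: "3 \<le> card (pverts G)"
  shows "hamiltonian G \<longleftrightarrow> \<not> no_ham_cycle (pverts G) (parcs G)"
proof -
  define C where "C xs = \<lparr> pverts = set xs,
     parcs = set (vwalk_arcs (xs @ [hd xs])) \<union> (set (vwalk_arcs (xs @ [hd xs])))\<inverse> \<rparr>" for xs :: "'a list"
  have "hamiltonian G \<longleftrightarrow> (\<exists>xs. 3 \<le> length xs \<and> distinct xs \<and> spanning (with_proj (C xs)) (with_proj G))"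
  proof -
    have "X = C xs \<longleftrightarrow> pverts X = set xs \<and> parcs X = set (vwalk_arcs (xs @ [hd xs])) \<union> (set (vwalk_arcs (xs @ [hd xs])))\<inverse>"
      for X and xs :: "'a list"
      unfolding C_def by (rule pair_pre_digraph_eq_iff)
    then show ?thesis unfolding hamiltonian_def cycle_graph_def by metis
  qed
  also have "\<dots> \<longleftrightarrow> (\<exists>xs\<in>ham_lists (pverts G) (parcs G). (last xs, hd xs) \<in> parcs G)"
  proof -
    have "3 \<le> length xs \<and> distinct xs \<and> spanning (with_proj (C xs)) (with_proj G) \<longleftrightarrow>
       xs \<in> ham_lists (pverts G) (parcs G) \<and> (last xs, hd xs) \<in> parcs G" for xs
    proof (cases "xs = []")
      case True
      then show ?thesis using n by (auto simp: ham_lists_def permutations_of_set_def)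
    next
      case False
      have sub: "parcs (C xs) \<subseteq> pverts (C xs) \<times> pverts (C xs)"
        using vwalk_arcs_in_set[of _ _ xs] False by (auto simp: C_def set_vwalk_arcs_snoc)
      have "spanning (with_proj (C xs)) (with_proj G) \<longleftrightarrow>
          set xs = pverts G \<and> insert (last xs, hd xs) (set (vwalk_arcs xs)) \<subseteq> parcs G"
        unfolding spanning_iff[OF G sub] using pair_graphD(3)[OF G] False
        by (auto simp: C_def set_vwalk_arcs_snoc dest: symD)
      then show ?thesis
        using n distinct_card[of xs] by (auto simp: ham_lists_def permutations_of_set_def)
    qed
    then show ?thesis by blast
  qed
  finally show ?thesis by (auto simp: no_ham_cycle_def)
qed

lemma ham_lists_rev: "sym E \<Longrightarrow> xs \<in> ham_lists V E \<Longrightarrow> rev xs \<in> ham_lists V E"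
  by (auto simp: ham_lists_def permutations_of_set_def vwalk_arcs_rev dest: symD)

text \<open>A chosen list for each path and its reversal are two different lists, since the ends
  differ; the Boolean in \<open>g\<close> selects between them.\<close>

lemma card_path_of_image:
  assumes V: "finite V" "2 \<le> card V" and E: "sym E"
  shows "2 * card (path_of ` ham_lists V E) \<le> card (ham_lists V E)"
proof -
  let ?L = "ham_lists V E"
  define g where "g = (\<lambda>(P, b). let xs = inv_into ?L path_of P in if b then xs else rev xs)"
  have g: "g (P, b) \<in> ?L" "path_of (g (P, b)) = P" if "P \<in> path_of ` ?L" for P b
    using inv_into_into[OF that] f_inv_into_f[OF that] ham_lists_rev[OF E]
    by (auto simp: g_def Let_def path_of_rev)
  have rev: "xs \<noteq> rev xs" if "xs \<in> ?L" for xs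
  proof
    assume "xs = rev xs"
    then have "xs ! 0 = rev xs ! 0" by simp
    then show False
      using ham_listsD(1,3)[OF that] V by (auto simp: rev_nth nth_eq_iff_index_eq)
  qed
  have "inj_on g (path_of ` ?L \<times> UNIV)"
  proof (rule inj_onI, clarify)
    fix P b P' b' xs ys assume P: "xs \<in> ?L" "ys \<in> ?L" and eq: "g (path_of xs, b) = g (path_of ys, b')"
    have "path_of xs = path_of ys" using g(2)[of "path_of xs" b] g(2)[of "path_of ys" b'] P eq by auto
    moreover have "b = b'"
      using eq rev[OF inv_into_into[of "path_of ys" path_of ?L]] P \<open>path_of xs = path_of ys\<close>
      by (auto simp: g_def Let_def split: if_splits dest: sym)
    ultimately show "path_of xs = path_of ys \<and> b = b'" by simp
  qed
  moreover have "g ` (path_of ` ?L \<times> UNIV) \<subseteq> ?L" using g by auto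
  ultimately have "card (path_of ` ?L \<times> (UNIV :: bool set)) \<le> card ?L"
    using finite_ham_lists[OF V(1)] by (rule card_inj_on_le)
  then show ?thesis by (simp add: card_cartesian_product)
qed

section \<open>Graphs with a vertex of degree at most one\<close>

lemma pendant_end:
  assumes E: "sym E" and u: "E `` {u} \<subseteq> {c}" "u \<in> V" and xs: "xs \<in> ham_lists V E"
  shows "hd xs = u \<or> last xs = u"
proof (rule ccontr)
  assume ne: "\<not> (hd xs = u \<or> last xs = u)"
  have len: "length xs = card V" "set xs = V" "distinct xs" using ham_listsD[OF xs] by auto
  obtain i where i: "i < length xs" "xs ! i = u" using u(2) len by (metis in_set_conv_nth)
  have "xs \<noteq> []" using i by auto
  then have "i \<noteq> 0" "i \<noteq> length xs - 1" using ne i(2) by (metis hd_conv_nth last_conv_nth)+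
  then obtain j where j: "i = Suc j" "Suc i < length xs" using i by (cases i) auto
  have "(xs ! j, u) \<in> E" "(u, xs ! Suc i) \<in> E"
    using ham_listsD(4)[OF xs, of j] ham_listsD(4)[OF xs, of i] i j len by auto
  then have "xs ! j = c" "xs ! Suc i = c" using u(1) E by (auto dest: symD)
  then show False using j i len nth_eq_iff_index_eq[of xs j "Suc i"] by auto
qed

lemma pendant_no_ham_cycle:
  assumes V: "3 \<le> card V" and E: "sym E" and u: "E `` {u} \<subseteq> {c}" "u \<in> V"
  shows "no_ham_cycle V E"
  unfolding no_ham_cycle_def
proof
  fix xs assume xs: "xs \<in> ham_lists V E"
  have len: "length xs = card V" "distinct xs" using ham_listsD[OF xs] by auto
  show "(last xs, hd xs) \<notin> E"
  proof
    assume e: "(last xs, hd xs) \<in> E"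
    have e': "(xs ! (card V - 1), xs ! 0) \<in> E"
      using e len V by (simp add: last_conv_nth hd_conv_nth flip: length_greater_0_conv)
    have a: "(xs ! 0, xs ! 1) \<in> E" "(xs ! (card V - 2), xs ! (card V - 1)) \<in> E"
      using ham_listsD(4)[OF xs, of 0] ham_listsD(4)[OF xs, of "card V - 2"] V by (auto simp: numeral_2_eq_2 Suc_diff_Suc)
    from pendant_end[OF E u xs] have "xs ! 0 = u \<or> xs ! (card V - 1) = u"
      using len V by (auto simp: last_conv_nth hd_conv_nth simp flip: length_greater_0_conv)
    \<comment> \<open>The closing arc would give the end \<open>u\<close> a second neighbour on the
      cycle, and both neighbours would have to be \<open>c\<close>.\<close>
    then have "xs ! 1 = xs ! (card V - 1) \<or> xs ! (card V - 2) = xs ! 0"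
      using a e' u E by (auto dest: symD)
    then show False using len V by (auto simp: nth_eq_iff_index_eq)
  qed
qed

definition pendant_lists :: "'a set \<Rightarrow> 'a \<Rightarrow> 'a \<Rightarrow> 'a list set" where
  "pendant_lists V u c = (\<lambda>zs. u # c # zs) ` permutations_of_set (V - {u, c})"

lemma card_pendant_lists:
  assumes "finite V" "u \<in> V" "c \<in> V" "u \<noteq> c"
  shows "card (pendant_lists V u c) = fact (card V - 2)"
  using assms by (simp add: pendant_lists_def card_image inj_on_def card_Diff_subset numeral_2_eq_2)

lemma hd_ham_lists_subset:
  assumes V: "finite V" "2 \<le> card V" and u: "E `` {u} \<subseteq> {c}" "u \<in> V"
  shows "{xs \<in> ham_lists V E. hd xs = u} \<subseteq> pendant_lists V u c"
proof
  fix xs assume "xs \<in> {xs \<in> ham_lists V E. hd xs = u}"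
  then have xs: "distinct xs" "set xs = V" "set (vwalk_arcs xs) \<subseteq> E" "hd xs = u"
    by (auto simp: ham_lists_def permutations_of_set_def)
  have "length xs \<ge> 2" using xs V by (metis distinct_card)
  then obtain y zs where "xs = u # y # zs" using xs(4) by (cases xs; cases "tl xs") auto
  moreover have "y = c" using calculation xs(3) u by auto
  ultimately show "xs \<in> pendant_lists V u c"
    using xs by (auto simp: pendant_lists_def permutations_of_set_def)
qed

lemma path_of_image_hd:
  assumes E: "sym E" and u: "E `` {u} \<subseteq> {c}" "u \<in> V"
  shows "path_of ` ham_lists V E = path_of ` {xs \<in> ham_lists V E. hd xs = u}"
proof (intro equalityI subsetI)
  fix P assume "P \<in> path_of ` ham_lists V E"
  then obtain xs where xs: "xs \<in> ham_lists V E" "P = path_of xs" by blast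
  show "P \<in> path_of ` {xs \<in> ham_lists V E. hd xs = u}"
  proof (cases "hd xs = u")
    case False
    have "xs \<noteq> []" using xs(1) u(2) by (auto simp: ham_lists_def permutations_of_set_def)
    then have "hd (rev xs) = u" using pendant_end[OF E u xs(1)] False by (simp add: hd_rev)
    then show ?thesis using xs ham_lists_rev[OF E xs(1)] path_of_rev[of xs]
      by (intro image_eqI[of _ _ "rev xs"]) auto
  qed (use xs in auto)
qed auto

lemma card_path_of_hd:
  assumes "V \<noteq> {}"
  shows "card (path_of ` {xs \<in> ham_lists V E. hd xs = u}) = card {xs \<in> ham_lists V E. hd xs = u}"
  using assms by (intro card_image inj_onI path_of_inj)
    (auto simp: ham_lists_def permutations_of_set_def)

text \<open>Oriented to start at \<open>u\<close>, a Hamilton path has to continue with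
  \<open>c\<close>, and distinct lists from \<open>u\<close> give distinct paths. So the bound
  counts orders of the other vertices, and equality means that every order occurs.\<close>

lemma card_pendant_le:
  assumes V: "finite V" "2 \<le> card V" and E: "sym E"
    and u: "E `` {u} \<subseteq> {c}" "u \<in> V" "c \<in> V" "u \<noteq> c"
  shows "card (path_of ` ham_lists V E) \<le> fact (card V - 2)"
    and "card (path_of ` ham_lists V E) = fact (card V - 2) \<longleftrightarrow> pendant_lists V u c \<subseteq> ham_lists V E"
proof -
  let ?L = "{xs \<in> ham_lists V E. hd xs = u}"
  have sub: "?L \<subseteq> pendant_lists V u c" by (rule hd_ham_lists_subset[OF V u(1,2)])
  have fin: "finite (pendant_lists V u c)" using V by (simp add: pendant_lists_def)
  have "V \<noteq> {}" using u by auto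
  then have card: "card (path_of ` ham_lists V E) = card ?L"
    unfolding path_of_image_hd[OF E u(1,2)] by (rule card_path_of_hd)
  show "card (path_of ` ham_lists V E) \<le> fact (card V - 2)"
    unfolding card card_pendant_lists[OF V(1) u(2-4), symmetric] using fin sub by (rule card_mono)
  have "card ?L = fact (card V - 2) \<longleftrightarrow> ?L = pendant_lists V u c"
    unfolding card_pendant_lists[OF V(1) u(2-4), symmetric] using card_subset_eq[OF fin sub] by auto
  also have "\<dots> \<longleftrightarrow> pendant_lists V u c \<subseteq> ham_lists V E"
    using sub by (auto simp: pendant_lists_def)
  finally show "card (path_of ` ham_lists V E) = fact (card V - 2) \<longleftrightarrow> pendant_lists V u c \<subseteq> ham_lists V E"
    unfolding card .
qed

section \<open>The extremal graph\<close>

lemma pair_graph_K_dot_K2: "pair_graph (K_dot_K2 n)"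
proof
  show "finite (parcs (K_dot_K2 n))"
    by (rule finite_subset[of _ "pverts (K_dot_K2 n) \<times> pverts (K_dot_K2 n)"])
      (auto simp: K_dot_K2_def complete_graph_on_def)
  show "symmetric (with_proj (K_dot_K2 n))"
    by (auto simp: symmetric_def sym_def K_dot_K2_def complete_graph_on_def)
qed (auto simp: K_dot_K2_def complete_graph_on_def)

lemma K_dot_K2_simps:
  assumes "2 \<le> n"
  shows "pverts (K_dot_K2 n) = {0..<n}"
    and "parcs (K_dot_K2 n) = {(x, y). x < n - 1 \<and> y < n - 1 \<and> x \<noteq> y} \<union> {(0, n - 1), (n - 1, 0)}"
  using assms by (auto simp: K_dot_K2_def complete_graph_on_def)

lemma K_dot_K2_correct:
  assumes n: "3 \<le> n"
  shows "K_dot_K2 n \<in> nonhamiltonian_graphs n" "card (hamilton_paths (K_dot_K2 n)) = fact (n - 2)"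
proof -
  let ?G = "K_dot_K2 n" and ?V = "{0..<n}"
  note simps = K_dot_K2_simps[OF order.trans[OF _ n], simplified]
  have V: "pverts ?G = ?V" "card ?V = n" using simps by auto
  have E: "sym (parcs ?G)" using pair_graphD[OF pair_graph_K_dot_K2] by blast
  have u: "parcs ?G `` {n - 1} \<subseteq> {0}" using n by (auto simp: simps)
  have "no_ham_cycle ?V (parcs ?G)"
    using n E u by (intro pendant_no_ham_cycle) auto
  then show "?G \<in> nonhamiltonian_graphs n"
    using hamiltonian_iff[OF pair_graph_K_dot_K2] n V pair_graph_K_dot_K2
    by (auto simp: nonhamiltonian_graphs_def)
  have "pendant_lists ?V (n - 1) 0 \<subseteq> ham_lists ?V (parcs ?G)"
  proof
    fix xs assume "xs \<in> pendant_lists ?V (n - 1) 0"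
    then obtain zs where zs: "xs = (n - 1) # 0 # zs" "distinct zs" "set zs = ?V - {n - 1, 0}"
      by (auto simp: pendant_lists_def permutations_of_set_def)
    have less: "z < n - 1" if "z \<in> set (0 # zs)" for z
    proof -
      have "z = 0 \<or> z \<in> ?V - {n - 1, 0}" using that unfolding zs(3)[symmetric] by simp
      then show ?thesis using n by auto
    qed
    have "(x, y) \<in> parcs ?G" if e: "(x, y) \<in> set (vwalk_arcs (0 # zs))" for x y
    proof -
      have "x < n - 1" "y < n - 1" using vwalk_arcs_in_set[OF e] less by blast+
      note xy = this
      obtain i where "(0 # zs) ! i = x" "(0 # zs) ! Suc i = y" "Suc i < length (0 # zs)"
        using e unfolding set_vwalk_arcs_nth by blast
      moreover have "distinct (0 # zs)"
        using zs(2,3) by auto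
      ultimately have "x \<noteq> y" using nth_eq_iff_index_eq[of "0 # zs" i "Suc i"] by force
      then show ?thesis using xy by (simp add: simps)
    qed
    moreover have "(n - 1, 0) \<in> parcs ?G" by (simp add: simps)
    ultimately have "set (vwalk_arcs xs) \<subseteq> parcs ?G"
      using zs(1) by auto
    then show "xs \<in> ham_lists ?V (parcs ?G)"
      using zs n by (auto simp: ham_lists_def permutations_of_set_def)
  qed
  moreover have "?V \<noteq> {}" using n by auto
  ultimately show "card (hamilton_paths ?G) = fact (n - 2)"
    using card_pendant_le(2)[of ?V "parcs ?G" "n - 1" 0] E u n
    by (simp add: hamilton_paths_eq[OF pair_graph_K_dot_K2] V)
qed

text \<open>The order behind \<open>u\<close>, \<open>c\<close> is arbitrary, so \<open>y\<close>
  can be put right after \<open>c\<close>, or \<open>x\<close>, \<open>y\<close> can follow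
  \<open>c\<close> in this order; each such list being Hamiltonian forces the arc.\<close>

lemma pendant_lists_arcs:
  assumes V: "finite V" and u: "u \<in> V" "c \<in> V" "u \<noteq> c" "V - {u, c} \<noteq> {}"
    and sub: "pendant_lists V u c \<subseteq> ham_lists V E"
  shows "(u, c) \<in> E" and "x \<in> V - {u} \<Longrightarrow> y \<in> V - {u, c} \<Longrightarrow> x \<noteq> y \<Longrightarrow> (x, y) \<in> E"
proof -
  have arcs: "set (vwalk_arcs (u # c # zs)) \<subseteq> E" if "distinct zs" "set zs = V - {u, c}" for zs
  proof -
    have "u # c # zs \<in> pendant_lists V u c"
      using that by (auto simp: pendant_lists_def permutations_of_set_def)
    then have "u # c # zs \<in> ham_lists V E" using sub by blast
    then show ?thesis unfolding ham_lists_def by blast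
  qed
  obtain zs where "distinct zs" "set zs = V - {u, c}"
    using finite_distinct_list[of "V - {u, c}"] V by auto
  then show "(u, c) \<in> E" using arcs by fastforce
  assume xy: "x \<in> V - {u}" "y \<in> V - {u, c}" "x \<noteq> y"
  show "(x, y) \<in> E"
  proof (cases "x = c")
    case True
    obtain zs where "distinct zs" "set zs = V - {u, c} - {y}"
      using finite_distinct_list[of "V - {u, c} - {y}"] V by auto
    then show ?thesis using arcs[of "y # zs"] xy True by (auto simp: insert_absorb)
  next
    case False
    obtain zs where "distinct zs" "set zs = V - {u, c} - {x, y}"
      using finite_distinct_list[of "V - {u, c} - {x, y}"] V by auto
    then show ?thesis using arcs[of "x # y # zs"] xy False by (auto simp: insert_absorb)
  qed
qed

lemma K_dot_K2_iso:
  fixes G :: "'a pair_pre_digraph"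
  assumes G: "pair_graph G" and n: "card (pverts G) = n" "3 \<le> n"
    and u: "u \<in> pverts G" "c \<in> pverts G" "u \<noteq> c" "parcs G `` {u} \<subseteq> {c}"
    and arcs: "(u, c) \<in> parcs G"
      "\<And>x y. x \<in> pverts G - {u} \<Longrightarrow> y \<in> pverts G - {u, c} \<Longrightarrow> x \<noteq> y \<Longrightarrow> (x, y) \<in> parcs G"
  shows "digraph_iso (with_proj G) (with_proj (K_dot_K2 n))"
proof -
  let ?V = "pverts G" and ?E = "parcs G"
  note D = pair_graphD[OF G]
  note simps = K_dot_K2_simps[OF order.trans[OF _ n(2)], simplified]
  have "card (?V - {u, c}) = card {1..<n - 1}"
    using D(1) u n by (simp add: card_Diff_subset numeral_2_eq_2)
  then obtain f where f: "bij_betw f (?V - {u, c}) {1..<n - 1}"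
    using finite_same_card_bij[of "?V - {u, c}" "{1..<n - 1}"] D(1) by auto
  \<comment> \<open>Adjacency depends only on which vertices equal \<open>u\<close> or
    \<open>c\<close>, so these go to \<open>n - 1\<close> and \<open>0\<close> and the rest is
    matched arbitrarily.\<close>
  define g where "g x = (if x = u then n - 1 else if x = c then 0 else f x)" for x
  have "bij_betw g (?V - {u, c}) {1..<n - 1}"
    using f by (rule bij_betw_cong[THEN iffD1, rotated]) (simp add: g_def)
  then have "bij_betw g (?V - {u, c} \<union> {u, c}) ({1..<n - 1} \<union> {0, n - 1})"
    by (rule bij_betw_combine) (use u n in \<open>auto simp: bij_betw_def g_def inj_on_def\<close>)
  moreover have "?V - {u, c} \<union> {u, c} = ?V" "{1..<n - 1} \<union> {0, n - 1} = {0..<n}"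
    using u n by auto
  ultimately have g: "bij_betw g ?V {0..<n}" by simp
  then have inj: "inj_on g ?V" and im: "g ` ?V = {0..<n}" by (auto simp: bij_betw_def)
  have gu: "g u = n - 1" "g c = 0" using u by (auto simp: g_def)
  have glt: "g x < n - 1" if "x \<in> ?V - {u}" for x
  proof -
    have "g x \<in> {0..<n}" using im that by blast
    moreover have "g x \<noteq> g u" using inj that u by (auto simp: inj_on_def)
    ultimately show ?thesis using gu by auto
  qed
  have E: "(x, y) \<in> ?E \<longleftrightarrow> (g x, g y) \<in> parcs (K_dot_K2 n)" if xy: "x \<in> ?V" "y \<in> ?V" for x y
  proof -
    have eq: "g x = g y \<longleftrightarrow> x = y" "g x = n - 1 \<longleftrightarrow> x = u" "g y = n - 1 \<longleftrightarrow> y = u"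
      "g x = 0 \<longleftrightarrow> x = c" "g y = 0 \<longleftrightarrow> y = c"
      using inj xy u gu unfolding inj_on_def by metis+
    have lt: "g x < n - 1 \<longleftrightarrow> x \<noteq> u" "g y < n - 1 \<longleftrightarrow> y \<noteq> u" using glt xy gu by auto
    have sE: "(a, b) \<in> ?E \<longleftrightarrow> (b, a) \<in> ?E" for a b using D(3) by (auto dest: symD)
    have "(x, y) \<in> ?E \<longleftrightarrow> x \<noteq> u \<and> y \<noteq> u \<and> x \<noteq> y \<or> x = c \<and> y = u \<or> x = u \<and> y = c"
    proof
      assume e: "(x, y) \<in> ?E"
      have "x \<noteq> y" using e D(4) by (auto simp: irrefl_def)
      moreover have "y = c" if "x = u" using e u(4) that by auto
      moreover have "x = c" if "y = u" using e u(4) that sE by blast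
      ultimately show "x \<noteq> u \<and> y \<noteq> u \<and> x \<noteq> y \<or> x = c \<and> y = u \<or> x = u \<and> y = c" by blast
    next
      assume "x \<noteq> u \<and> y \<noteq> u \<and> x \<noteq> y \<or> x = c \<and> y = u \<or> x = u \<and> y = c"
      then show "(x, y) \<in> ?E"
        using arcs(1) arcs(2)[of x y] arcs(2)[of y x] xy sE by blast
    qed
    then show ?thesis using eq lt n(2) by (auto simp: simps)
  qed
  define \<phi> where "\<phi> = \<lparr>iso_verts = g, iso_arcs = map_prod g g, iso_head = snd, iso_tail = fst\<rparr>"
  have "wf_digraph (with_proj G)" using D(2) by unfold_locales auto
  moreover have "inj_on (map_prod g g) ?E"
    using inj D(2) by (intro inj_on_subset[OF map_prod_inj_on[OF inj inj]])
  ultimately have "pre_digraph.digraph_isomorphism (with_proj G) \<phi>"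
    using inj by (simp add: pre_digraph.digraph_isomorphism_def \<phi>_def)
  moreover have "parcs (K_dot_K2 n) = map_prod g g ` ?E"
  proof (intro equalityI subsetI)
    fix e assume e: "e \<in> parcs (K_dot_K2 n)"
    then have "e \<in> {0..<n} \<times> {0..<n}" using n(2) by (auto simp: simps)
    then obtain x y where "x \<in> ?V" "y \<in> ?V" "e = (g x, g y)" unfolding im[symmetric] by auto
    then show "e \<in> map_prod g g ` ?E" using E e by force
  next
    fix e assume "e \<in> map_prod g g ` ?E"
    then show "e \<in> parcs (K_dot_K2 n)" using E D(2) by auto
  qed
  then have "with_proj (K_dot_K2 n) = app_iso \<phi> (with_proj G)"
    using im simps(1) by (simp add: app_iso_def \<phi>_def with_proj_def)
  ultimately show ?thesis unfolding digraph_iso_def by blast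
qed

theorem corollary3:
  fixes n :: nat
  assumes "n \<ge> 6"
  shows "(K_dot_K2 n \<in> nonhamiltonian_graphs n \<and>
          card (hamilton_paths (K_dot_K2 n)) = fact (n - 2)) \<and>
         (\<forall>G :: 'a pair_pre_digraph. G \<in> nonhamiltonian_graphs n \<longrightarrow>
            card (hamilton_paths G) \<le> fact (n - 2) \<and>
            (card (hamilton_paths G) = fact (n - 2) \<longrightarrow>
               digraph_iso (with_proj G) (with_proj (K_dot_K2 n))))"
proof (intro conjI allI impI)
  show "K_dot_K2 n \<in> nonhamiltonian_graphs n" "card (hamilton_paths (K_dot_K2 n)) = fact (n - 2)"
    using K_dot_K2_correct assms by auto
  fix G :: "'a pair_pre_digraph"
  assume "G \<in> nonhamiltonian_graphs n"
  then have G: "pair_graph G" and V: "card (pverts G) = n" and "\<not> hamiltonian G"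
    by (auto simp: nonhamiltonian_graphs_def)
  note D = pair_graphD[OF G]
  have nh: "no_ham_cycle (pverts G) (parcs G)"
    using hamiltonian_iff[OF G] \<open>\<not> hamiltonian G\<close> V assms by simp
  have ne: "pverts G \<noteq> {}" using V assms by auto
  note paths = hamilton_paths_eq[OF G ne]
  have "card (hamilton_paths G) \<le> fact (n - 2) \<and>
      (card (hamilton_paths G) = fact (n - 2) \<longrightarrow> digraph_iso (with_proj G) (with_proj (K_dot_K2 n)))"
  proof (cases "\<forall>u\<in>pverts G. 2 \<le> deg (parcs G) u")
    case True
    then have "card (ham_lists (pverts G) (parcs G)) < 2 * fact (n - 2)"
      using ham_lists_less[OF D(1) _ D(2-4) nh] V assms by simp
    moreover have "2 * card (hamilton_paths G) \<le> card (ham_lists (pverts G) (parcs G))"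
      unfolding paths using D V assms by (intro card_path_of_image) auto
    ultimately have "card (hamilton_paths G) < fact (n - 2)" by linarith
    then show ?thesis by simp
  next
    case False
    then obtain u where u: "u \<in> pverts G" "deg (parcs G) u \<le> 1" by force
    have "\<exists>c\<in>pverts G. u \<noteq> c \<and> parcs G `` {u} \<subseteq> {c}"
    proof (cases "parcs G `` {u} = {}")
      case True
      \<comment> \<open>For an isolated \<open>u\<close> any other vertex can play the part of
        \<open>c\<close>; the equality case then yields the arc \<open>(u, c)\<close> and thereby a
        contradiction or the isomorphism alike.\<close>
      have "pverts G \<noteq> {u}" using V assms by auto
      then obtain c where "c \<in> pverts G" "c \<noteq> u" using u(1) by blast
      then show ?thesis using True by (intro bexI[of _ c]) auto
    next
      case False
      then obtain c where c: "(u, c) \<in> parcs G" by auto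
      have "finite (parcs G `` {u})" using D(1,2) by (auto intro: finite_subset[of _ "pverts G"])
      then have "\<forall>x\<in>parcs G `` {u}. \<forall>y\<in>parcs G `` {u}. x = y"
        using u(2) card_le_Suc0_iff_eq unfolding deg_def One_nat_def by blast
      then have "parcs G `` {u} \<subseteq> {c}" using c by blast
      moreover have "c \<in> pverts G" "u \<noteq> c" using c D(2,4) by (auto simp: irrefl_def)
      ultimately show ?thesis by blast
    qed
    then obtain c where c: "c \<in> pverts G" "u \<noteq> c" "parcs G `` {u} \<subseteq> {c}" by blast
    have two: "2 \<le> card (pverts G)" using V assms by simp
    note le = card_pendant_le[OF D(1) two D(3) c(3) u(1) c(1,2)]
    show ?thesis
    proof (intro conjI impI)
      show "card (hamilton_paths G) \<le> fact (n - 2)" using le(1) V paths by simp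
      assume "card (hamilton_paths G) = fact (n - 2)"
      then have sub: "pendant_lists (pverts G) u c \<subseteq> ham_lists (pverts G) (parcs G)"
        using le(2) V paths by simp
      have "pverts G - {u, c} \<noteq> {}"
      proof
        assume "pverts G - {u, c} = {}"
        then have "card (pverts G) \<le> card {u, c}" by (intro card_mono) auto
        then show False using V assms c(2) by simp
      qed
      note arcs = pendant_lists_arcs[OF D(1) u(1) c(1,2) this sub]
      show "digraph_iso (with_proj G) (with_proj (K_dot_K2 n))"
        using V assms by (intro K_dot_K2_iso[OF G _ _ u(1) c arcs]) auto
    qed
  qed
  then show "card (hamilton_paths G) \<le> fact (n - 2)"
    and "card (hamilton_paths G) = fact (n - 2) \<Longrightarrow> digraph_iso (with_proj G) (with_proj (K_dot_K2 n))"
    by auto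
qed

end
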